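(* Let $q$ be a positive integer, let $\delta\in(0,\frac12)$, and let $A(q,\delta):=\#\{a\in\{1,\dots,q\}:\ \|a^2/q\|<\delta\}$. Let $r$ be the largest integer such that $r^2\mid q$. Then for any $\varepsilon>0$, $$A(q,\delta)\ll \delta q+r^{1+\varepsilon}+\delta^{\frac12}q^{\frac{11}{16}+\varepsilon},$$ where the implied constant depends only on $\varepsilon$.
   Context: $\|\cdot\|$ denotes the distance to the nearest integer. *)

theory Defs
  imports Complex_Main
begin

definition dist_nearest_int :: "real \<Rightarrow> real" where
  "dist_nearest_int x = \<bar>x - of_int (round x)\<bar>"

definition A_count :: "nat \<Rightarrow> real \<Rightarrow> nat" where
  "A_count q \<delta> = card {a \<in> {1..q}. dist_nearest_int (real (a ^ 2) / real q) < \<delta>}"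

(* Only meaningful for q > 0: for q = 0 the set is infinite and Max is unspecified. *)
definition largest_square_root_divisor :: "nat \<Rightarrow> nat" where
  "largest_square_root_divisor q = Max {s. s ^ 2 dvd q}"

lemma finite_square_divisors:
  assumes "q > (0::nat)"
  shows "finite {s::nat. s ^ 2 dvd q}"
proof (rule finite_subset)
  show "{s. s ^ 2 dvd q} \<subseteq> {..q}"
  proof
    fix s assume "s \<in> {s. s ^ 2 dvd q}"
    then have "s dvd q" by (auto simp: power2_eq_square elim: dvd_mult_left)
    then show "s \<in> {..q}" using assms by (auto dest: dvd_imp_le)
  qed
qed simp

lemma largest_square_root_divisor:
  assumes "q > 0"
  shows "largest_square_root_divisor q ^ 2 dvd q"
    and "s ^ 2 dvd q \<Longrightarrow> s \<le> largest_square_root_divisor q"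
proof -
  have "1 \<in> {s::nat. s ^ 2 dvd q}" by simp
  then have "Max {s. s ^ 2 dvd q} \<in> {s. s ^ 2 dvd q}"
    using finite_square_divisors[OF assms] by (intro Max_in) blast+
  then show "largest_square_root_divisor q ^ 2 dvd q"
    by (simp add: largest_square_root_divisor_def)
  show "s \<le> largest_square_root_divisor q" if "s ^ 2 dvd q"
    unfolding largest_square_root_divisor_def
    using finite_square_divisors[OF assms] that by (intro Max_ge) auto
qed

lemma dist_nearest_int_le: "dist_nearest_int x \<le> \<bar>x - of_int n\<bar>"
  unfolding dist_nearest_int_def by (rule round_diff_minimal)

end

theory Submission
  imports Defs "HOL-Number_Theory.Number_Theory" "HOL-Analysis.Convex"
begin

text \<open>
  Write \<open>N = \<delta> q\<close> and split off \<open>e = gcd a r\<close>. A residue \<open>n\<close> modulo \<open>q / e\<^sup>2\<close> that is coprime to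
  \<open>r / e\<close> has at most \<open>4 \<Prod> (1 + \<chi>\<^sub>p(n))\<close> square roots, the product running over the odd primes
  dividing \<open>q / e\<^sup>2\<close>; the integers \<open>\<bar>n\<bar> < N / e\<^sup>2\<close> have to be counted with this weight.
  If \<open>N < q\<^bsup>3/8\<^esup>\<close>, it suffices that the weight is \<open>O(q\<^bsup>o(1)\<^esup>)\<close>. Otherwise the primes above
  \<open>q\<^bsup>1/96\<^esup>\<close>, of which there are at most 96, are discarded at the cost of a constant factor, and the
  remaining product is expanded into quadratic characters of smooth conductor \<open>d\<close>. The terms with
  \<open>d = 1\<close> add up to \<open>O(N)\<close> since \<open>\<Sum> \<phi>(r / e) = r\<close>; for the others any power saving over the
  trivial bound is enough, so Burgess' estimate for general moduli is not needed.

  That saving comes from factorizing \<open>d = D d\<^sub>1 d\<^sub>2 d\<^sub>3\<close> with \<open>D d\<^sub>i\<close> slightly smaller than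
  \<open>q\<^bsup>3/8\<^esup>\<close> and averaging over the translations \<open>n + d\<^sub>1 z + d\<^sub>2 y + d\<^sub>3 x\<close> with \<open>x, y, z < D\<close>.
  Repeated Cauchy--Schwarz reduces the average to the Gowers \<open>U\<^sup>3\<close> norm of the character modulo \<open>D\<close>,
  which is multiplicative and can be bounded elementarily at primes.
\<close>

section \<open>Quadratic characters and complete sums\<close>

text \<open>The term \<open>\<delta> * q\<close> carries no factor \<open>q powr \<epsilon>\<close>,
  so a loss of \<open>q^o(1)\<close> is affordable only while \<open>N\<close> is at most
  \<open>\<delta> powr (1/2) * q powr (11/16)\<close>. Writing
  \<open>N = N powr (1/2) * N powr (1/2)\<close> and \<open>N = \<delta> * q\<close>, this is the
  same as \<open>N \<le> q powr (3/8)\<close>; hence the threshold. The number 3/8 also fixes the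
  number of factors of the conductor. With \<open>k\<close> factors of comparable size the
  translations have length about \<open>q powr (1/k)\<close>, and they have to be shorter than the
  interval. Two factors would only reach intervals longer than \<open>q powr (1/2)\<close>;
  \<open>k = 3\<close> is the first value with 1/k < 3/8, and three factors lead to the
  \<open>U^3\<close> norm. The margin 3/8 - 1/3 = 4/96 is spent on \<open>D\<close>, which uses up
  to 3/96, and the last 1/96 is the saving against \<open>N\<close>. The smoothness level
  \<open>q powr (1/96)\<close> is the precision with which a product of primes can be fitted to a
  prescribed size.\<close>

definition mod_periodic :: "int \<Rightarrow> (int \<Rightarrow> real) \<Rightarrow> bool" where
  "mod_periodic D f \<longleftrightarrow> (\<forall>x y. [x = y] (mod D) \<longrightarrow> f x = f y)"

lemma mod_periodicI: "(\<And>x y. [x = y] (mod D) \<Longrightarrow> f x = f y) \<Longrightarrow> mod_periodic D f"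
  by (simp add: mod_periodic_def)

lemma mod_periodicD: "mod_periodic D f \<Longrightarrow> [x = y] (mod D) \<Longrightarrow> f x = f y"
  by (simp add: mod_periodic_def)

section \<open>Complete sums of periodic functions\<close>

lemma sum_periodic_affine:
  fixes D c b :: int
  assumes "D > 0" "coprime c D" "mod_periodic D f"
  shows "(\<Sum>x\<in>{0..<D}. f (c * x + b)) = (\<Sum>x\<in>{0..<D}. f x)"
proof -
  define g where "g x = (c * x + b) mod D" for x
  have inj: "inj_on g {0..<D}"
  proof (rule inj_onI)
    fix x y assume xy: "x \<in> {0..<D}" "y \<in> {0..<D}" "g x = g y"
    then have "[c * x + b = c * y + b] (mod D)" by (simp add: g_def cong_def)
    then have "[c * x = c * y] (mod D)" by (simp add: cong_add_rcancel)
    then have "[x = y] (mod D)" using assms(2) cong_mult_lcancel by blast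
    then show "x = y" using xy(1,2) by (simp add: cong_def)
  qed
  have "g ` {0..<D} \<subseteq> {0..<D}" using assms(1) by (auto simp: g_def)
  then have "g ` {0..<D} = {0..<D}" using inj by (simp add: endo_inj_surj)
  then have bij: "bij_betw g {0..<D} {0..<D}" using inj by (simp add: bij_betw_def)
  have "(\<Sum>x\<in>{0..<D}. f (c * x + b)) = (\<Sum>x\<in>{0..<D}. f (g x))"
    by (intro sum.cong refl mod_periodicD[OF assms(3)]) (simp add: g_def cong_def)
  also have "\<dots> = (\<Sum>x\<in>{0..<D}. f x)" by (rule sum.reindex_bij_betw[OF bij])
  finally show ?thesis .
qed

lemma sum_periodic_shift:
  fixes D b :: int
  assumes "D > 0" "mod_periodic D f"
  shows "(\<Sum>x\<in>{0..<D}. f (x + b)) = (\<Sum>x\<in>{0..<D}. f x)"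
  using sum_periodic_affine[OF assms(1) _ assms(2), of 1 b] by simp

text \<open>Chinese remainder theorem in the form \<open>x = n * i + m * j\<close>: modulo
  \<open>m\<close> only \<open>n * i\<close> is visible to \<open>f\<close>, modulo \<open>n\<close>
  only \<open>m * j\<close> to \<open>g\<close>, and the unit factors are then removed by
  \<open>sum_periodic_affine\<close>.\<close>

lemma sum_periodic_mult_coprime:
  fixes m n :: int
  assumes "m > 0" "n > 0" and cop: "coprime m n"
    and f: "mod_periodic m f" and g: "mod_periodic n g"
  shows "(\<Sum>x\<in>{0..<m * n}. f x * g x) = (\<Sum>x\<in>{0..<m}. f x) * (\<Sum>x\<in>{0..<n}. g x)"
proof -
  define h where "h = (\<lambda>(i, j). (n * i + m * j) mod (m * n))"
  have inj: "inj_on h ({0..<m} \<times> {0..<n})"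
  proof (rule inj_onI, clarify)
    fix i j i' j' assume *: "i \<in> {0..<m}" "j \<in> {0..<n}" "i' \<in> {0..<m}" "j' \<in> {0..<n}"
      and "h (i, j) = h (i', j')"
    then have c: "[n * i + m * j = n * i' + m * j'] (mod (m * n))"
      by (simp add: h_def cong_def)
    have "[n * i + m * j = n * i' + m * j'] (mod m)"
      using c by (rule cong_dvd_modulus) simp
    then have "[n * i = n * i'] (mod m)" by (simp add: cong_def)
    then have "[i = i'] (mod m)" using cop cong_mult_lcancel coprime_commute by blast
    then have 1: "i = i'" using * by (simp add: cong_def)
    have "[n * i + m * j = n * i' + m * j'] (mod n)"
      using c by (rule cong_dvd_modulus) simp
    then have "[m * j = m * j'] (mod n)" by (simp add: cong_def)
    then have "[j = j'] (mod n)" using cop cong_mult_lcancel by blast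
    then have "j = j'" using * by (simp add: cong_def)
    with 1 show "i = i' \<and> j = j'" by simp
  qed
  have sub: "h ` ({0..<m} \<times> {0..<n}) \<subseteq> {0..<m * n}" using assms(1,2) by (auto simp: h_def)
  have "card (h ` ({0..<m} \<times> {0..<n})) = card {0..<m * n}"
    using assms(1,2) by (simp add: card_image[OF inj] nat_mult_distrib)
  then have "h ` ({0..<m} \<times> {0..<n}) = {0..<m * n}"
    using sub by (simp add: card_subset_eq)
  then have bij: "bij_betw h ({0..<m} \<times> {0..<n}) {0..<m * n}"
    using inj by (simp add: bij_betw_def)
  have fg: "f (h (i, j)) = f (n * i)" "g (h (i, j)) = g (m * j)" for i j
  proof -
    have c: "[h (i, j) = n * i + m * j] (mod (m * n))" by (simp add: h_def cong_def)
    have "[h (i, j) = n * i + m * j] (mod m)" using c by (rule cong_dvd_modulus) simp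
    then have "[h (i, j) = n * i] (mod m)" by (simp add: cong_def)
    then show "f (h (i, j)) = f (n * i)" by (rule mod_periodicD[OF f])
    have "[h (i, j) = n * i + m * j] (mod n)" using c by (rule cong_dvd_modulus) simp
    then have "[h (i, j) = m * j] (mod n)" by (simp add: cong_def)
    then show "g (h (i, j)) = g (m * j)" by (rule mod_periodicD[OF g])
  qed
  have "(\<Sum>x\<in>{0..<m * n}. f x * g x) = (\<Sum>z\<in>{0..<m} \<times> {0..<n}. f (h z) * g (h z))"
    by (rule sum.reindex_bij_betw[OF bij, symmetric])
  also have "\<dots> = (\<Sum>(i, j)\<in>{0..<m} \<times> {0..<n}. f (n * i) * g (m * j))"
    by (intro sum.cong refl) (auto simp: fg)
  also have "\<dots> = (\<Sum>i\<in>{0..<m}. f (n * i)) * (\<Sum>j\<in>{0..<n}. g (m * j))"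
    by (simp add: sum_product sum.cartesian_product)
  also have "(\<Sum>i\<in>{0..<m}. f (n * i)) = (\<Sum>i\<in>{0..<m}. f i)"
    using sum_periodic_affine[OF assms(1) _ f, of n 0] cop by (simp add: coprime_commute)
  also have "(\<Sum>j\<in>{0..<n}. g (m * j)) = (\<Sum>j\<in>{0..<n}. g j)"
    using sum_periodic_affine[OF assms(2) _ g, of m 0] cop by simp
  finally show ?thesis .
qed

section \<open>Jacobi symbols and their correlations\<close>

text \<open>For a finite set of odd primes this is the Jacobi symbol modulo \<open>\<Prod>T\<close>.
  Indexing by the set instead of the modulus turns a factorization of the conductor into a disjoint
  union, and the expansion of a product over primes into a sum over subsets.\<close>

definition chi :: "nat set \<Rightarrow> int \<Rightarrow> real" where
  "chi T n = (\<Prod>p\<in>T. of_int (Legendre n (int p)))"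

lemma Legendre_cong: "[a = b] (mod p) \<Longrightarrow> Legendre a p = Legendre b p"
  by (simp add: Legendre_def QuadRes_def cong_def)

text \<open>Euler's criterion gives the identity modulo \<open>p\<close>; both sides lie in {-1, 0,
  1}, so they differ by at most 2, which is less than \<open>p\<close>.\<close>

lemma Legendre_mult:
  assumes "prime p" "odd (p::nat)"
  shows "Legendre (a * b) (int p) = Legendre a (int p) * Legendre b (int p)"
proof -
  have p: "2 < p" using assms by (metis prime_ge_2_nat even_numeral order_le_imp_less_or_eq)
  have "[Legendre (a * b) p = (a * b) ^ ((p - 1) div 2)] (mod p)"
    by (rule euler_criterion[OF assms(1) p])
  also have "(a * b) ^ ((p - 1) div 2) = a ^ ((p - 1) div 2) * b ^ ((p - 1) div 2)"
    by (simp add: power_mult_distrib)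
  also have "[\<dots> = Legendre a p * Legendre b p] (mod p)"
    by (intro cong_mult cong_sym[OF euler_criterion[OF assms(1) p]])
  finally have c: "int p dvd Legendre (a * b) p - Legendre a p * Legendre b p"
    by (simp add: cong_iff_dvd_diff)
  have "\<bar>Legendre (a * b) p - Legendre a p * Legendre b p\<bar> \<le> 2"
    by (auto simp: Legendre_def)
  with p c show ?thesis
    using zdvd_not_zless[of "\<bar>Legendre (a * b) p - Legendre a p * Legendre b p\<bar>" "int p"] by fastforce
qed

lemma chi_empty [simp]: "chi {} n = 1" by (simp add: chi_def)

lemma chi_insert: "finite T \<Longrightarrow> p \<notin> T \<Longrightarrow> chi (insert p T) n = chi {p} n * chi T n"
  by (simp add: chi_def)

lemma chi_Un_disjoint:
  "finite S \<Longrightarrow> finite T \<Longrightarrow> S \<inter> T = {} \<Longrightarrow> chi (S \<union> T) n = chi S n * chi T n"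
  by (simp add: chi_def prod.union_disjoint)

lemma abs_chi_le: "\<bar>chi T n\<bar> \<le> 1"
  unfolding chi_def abs_prod by (intro prod_le_1) (auto simp: Legendre_def)

lemma chi_periodic: "mod_periodic (int (\<Prod>T)) (chi T)"
proof (cases "finite T")
  case True
  show ?thesis
  proof (rule mod_periodicI)
    fix x y assume c: "[x = y] (mod int (\<Prod>T))"
    show "chi T x = chi T y" unfolding chi_def
    proof (intro prod.cong refl arg_cong[of _ _ of_int] Legendre_cong)
      fix p assume "p \<in> T"
      then have "int p dvd int (\<Prod>T)" using True by (simp add: dvd_prodI)
      then show "[x = y] (mod int p)" using c cong_dvd_modulus by blast
    qed
  qed
qed (auto simp: mod_periodic_def chi_def)

definition odd_primes :: "nat set \<Rightarrow> bool" where
  "odd_primes T \<longleftrightarrow> finite T \<and> (\<forall>p\<in>T. prime p \<and> odd p)"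

lemma odd_primes_subset: "odd_primes T \<Longrightarrow> S \<subseteq> T \<Longrightarrow> odd_primes S"
  by (auto simp: odd_primes_def dest: finite_subset)

lemma odd_primes_prod_pos: "odd_primes T \<Longrightarrow> \<Prod>T > 0"
  by (auto simp: odd_primes_def intro!: prod_pos prime_gt_0_nat)

lemma coprime_prod_disjoint:
  assumes "odd_primes S" "odd_primes T" "S \<inter> T = {}"
  shows "coprime (\<Prod>S) (\<Prod>T)"
  using assms
  by (intro prod_coprime_left prod_coprime_right primes_coprime_nat) (auto simp: odd_primes_def)

lemma chi_mult: "odd_primes T \<Longrightarrow> chi T (a * b) = chi T a * chi T b"
  unfolding chi_def odd_primes_def
  by (subst prod.distrib[symmetric], intro prod.cong refl) (auto simp: Legendre_mult)

lemma coprime_int_prime: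
  assumes "prime p" "\<not> int p dvd a"
  shows "coprime a (int p)"
proof -
  have "prime (int p)" using assms(1) by simp
  then show ?thesis using assms(2) prime_imp_coprime coprime_commute by blast
qed

lemma chi_self_sq:
  assumes "prime p" "\<not> int p dvd a"
  shows "(chi {p} a)\<^sup>2 = 1"
  using assms by (simp add: chi_def Legendre_def cong_0_iff)

text \<open>If every residue were a square, squaring would be a surjection of a finite set onto
  itself and hence injective, but \<open>1\<close> and \<open>p - 1\<close> have the same
  square.\<close>

lemma exists_nonresidue:
  assumes "prime p" "odd (p::nat)"
  shows "\<exists>a. chi {p} a = -1"
proof (rule ccontr)
  assume neg: "\<not> ?thesis"
  have p: "2 < p" using assms by (metis prime_ge_2_nat even_numeral order_le_imp_less_or_eq)
  define g where "g x = (x\<^sup>2) mod int p" for x :: int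
  have all: "\<exists>y. [y\<^sup>2 = a] (mod int p)" for a
  proof (cases "[a = 0] (mod int p)")
    case True
    then show ?thesis by (intro exI[of _ 0]) (simp add: cong_sym)
  next
    case False
    have "QuadRes (int p) a"
    proof (rule ccontr)
      assume "\<not> QuadRes (int p) a"
      then have "chi {p} a = -1" using False by (simp add: chi_def Legendre_def)
      with neg show False by blast
    qed
    then show ?thesis by (simp add: QuadRes_def)
  qed
  have "{0..<int p} \<subseteq> g ` {0..<int p}"
  proof
    fix a assume a: "a \<in> {0..<int p}"
    obtain y where y: "[y\<^sup>2 = a] (mod int p)" using all by blast
    have "g (y mod int p) = a" using a y by (simp add: g_def cong_def power_mod)
    moreover have "y mod int p \<in> {0..<int p}" using p by simp
    ultimately show "a \<in> g ` {0..<int p}" by blast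
  qed
  moreover have "g ` {0..<int p} \<subseteq> {0..<int p}" using p by (auto simp: g_def)
  ultimately have "inj_on g {0..<int p}" by (simp add: eq_card_imp_inj_on)
  moreover have "g 1 = g (int p - 1)"
  proof -
    have "(int p - 1)\<^sup>2 = 1 + int p * (int p - 2)" by (simp add: power2_eq_square algebra_simps)
    then show ?thesis unfolding g_def by (metis mod_mult_self2 one_power2)
  qed
  ultimately have "1 = int p - 1" using p by (auto dest!: inj_onD)
  with p show False by simp
qed

text \<open>Multiplication by a nonresidue permutes the residues and changes the sign of the
  sum.\<close>

lemma sum_chi_prime:
  assumes "prime p" "odd (p::nat)"
  shows "(\<Sum>x\<in>{0..<int p}. chi {p} x) = 0"
proof -
  obtain a where a: "chi {p} a = -1" using exists_nonresidue[OF assms] by blast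
  have op: "odd_primes {p}" using assms by (simp add: odd_primes_def)
  have "\<not> int p dvd a" using a by (auto simp: chi_def Legendre_def cong_0_iff split: if_splits)
  then have cop: "coprime a (int p)"
    using assms(1) by (simp add: coprime_int_prime)
  have "(\<Sum>x\<in>{0..<int p}. chi {p} x) = (\<Sum>x\<in>{0..<int p}. chi {p} (a * x + 0))"
    using assms chi_periodic[of "{p}"] cop
    by (intro sum_periodic_affine[symmetric]) (auto simp: prime_gt_0_nat)
  also have "\<dots> = - (\<Sum>x\<in>{0..<int p}. chi {p} x)"
    by (simp add: chi_mult[OF op] a sum_negf)
  finally show ?thesis by simp
qed

lemma sum_chi_complete:
  assumes "odd_primes T" "T \<noteq> {}"
  shows "(\<Sum>x\<in>{0..<int (\<Prod>T)}. chi T x) = 0"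
proof -
  obtain p where p: "p \<in> T" using assms by blast
  define U where "U = T - {p}"
  have T: "T = {p} \<union> U" "{p} \<inter> U = {}" using p by (auto simp: U_def)
  have op: "odd_primes {p}" "odd_primes U"
    using assms(1) odd_primes_subset[of T] p by (auto simp: U_def)
  have fin: "finite U" using op by (simp add: odd_primes_def)
  have "\<Prod>T = p * \<Prod>U" using T fin by simp
  then have "(\<Sum>x\<in>{0..<int (\<Prod>T)}. chi T x) = (\<Sum>x\<in>{0..<int p * int (\<Prod>U)}. chi {p} x * chi U x)"
    using T fin by (simp only: chi_Un_disjoint finite.intros) simp
  also have "\<dots> = (\<Sum>x\<in>{0..<int p}. chi {p} x) * (\<Sum>x\<in>{0..<int (\<Prod>U)}. chi U x)"
    using odd_primes_prod_pos[OF op(1)] odd_primes_prod_pos[OF op(2)] chi_periodic[of "{p}"]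
      coprime_prod_disjoint[OF op T(2)]
    by (intro sum_periodic_mult_coprime chi_periodic) (auto simp del: of_nat_prod)
  also have "\<dots> = 0" using assms p by (simp add: odd_primes_def sum_chi_prime)
  finally show ?thesis .
qed

text \<open>Scaling \<open>x\<close> by \<open>k\<close> shows that all nonzero shifts give the same
  value. The sum over all shifts contains the vanishing complete sum of the character, and the shift
  0 contributes \<open>p - 1\<close>, so the other \<open>p - 1\<close> equal values add up to
  \<open>- (p - 1)\<close>.\<close>

lemma chi_correlation_prime:
  assumes p: "prime p" "odd (p::nat)" and "\<not> int p dvd k"
  shows "(\<Sum>x\<in>{0..<int p}. chi {p} x * chi {p} (x + k)) = -1"
proof -
  define c where "c k = (\<Sum>x\<in>{0..<int p}. chi {p} x * chi {p} (x + k))" for k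
  have op: "odd_primes {p}" using p by (simp add: odd_primes_def)
  have per: "mod_periodic (int p) (chi {p})" using chi_periodic[of "{p}"] by simp
  have pos: "int p > 0" using p by (simp add: prime_gt_0_nat)
  have scale: "c k = c 1" if k: "\<not> int p dvd k" for k
  proof -
    have cop: "coprime k (int p)" using k p(1)
      by (simp add: coprime_int_prime)
    have "c k = (\<Sum>x\<in>{0..<int p}. chi {p} (k * x + 0) * chi {p} ((k * x + 0) + k))"
      unfolding c_def
      by (rule sum_periodic_affine[OF pos cop, symmetric])
        (auto intro!: mod_periodicI arg_cong2[of _ _ _ _ "(*)"] mod_periodicD[OF per] simp: cong_add_rcancel)
    also have "\<dots> = (\<Sum>x\<in>{0..<int p}. (chi {p} k)\<^sup>2 * (chi {p} x * chi {p} (x + 1)))"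
    proof (intro sum.cong refl)
      fix x
      have "(k * x + 0) + k = k * (x + 1)" by (simp add: algebra_simps)
      then show "chi {p} (k * x + 0) * chi {p} ((k * x + 0) + k)
          = (chi {p} k)\<^sup>2 * (chi {p} x * chi {p} (x + 1))"
        by (simp only: chi_mult[OF op] add_0_right power2_eq_square) simp
    qed
    also have "\<dots> = c 1" by (simp add: chi_self_sq[OF p(1) k] c_def)
    finally show ?thesis .
  qed
  have c0: "c 0 = real p - 1"
  proof -
    have "c 0 = (\<Sum>x\<in>{0..<int p}. if x = 0 then 0 else 1)"
      unfolding c_def
    proof (intro sum.cong refl)
      fix x assume x: "x \<in> {0..<int p}"
      show "chi {p} x * chi {p} (x + 0) = (if x = 0 then 0 else 1)"
      proof (cases "x = 0")
        case True then show ?thesis by (simp add: chi_def Legendre_def)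
      next
        case False
        then have "\<not> int p dvd x" using x zdvd_not_zless[of x "int p"] by auto
        then show ?thesis using chi_self_sq[OF p(1), of x] False by (simp add: power2_eq_square)
      qed
    qed
    also have "\<dots> = (\<Sum>x\<in>{1..<int p}. 1)"
      by (rule sum.mono_neutral_cong_right) (auto)
    finally show ?thesis using pos by simp
  qed
  have "(\<Sum>k\<in>{0..<int p}. c k) = (\<Sum>x\<in>{0..<int p}. chi {p} x * (\<Sum>k\<in>{0..<int p}. chi {p} (k + x)))"
    unfolding c_def by (subst sum.swap) (simp add: sum_distrib_left add.commute)
  also have "\<dots> = 0"
    by (simp add: sum_periodic_shift[OF pos per] sum_chi_prime[OF p])
  finally have "(\<Sum>k\<in>{0..<int p}. c k) = 0" .
  moreover have "{0..<int p} = insert 0 {1..<int p}" using pos by auto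
  then have "(\<Sum>k\<in>{0..<int p}. c k) = c 0 + (\<Sum>k\<in>{1..<int p}. c k)" by simp
  moreover have "(\<Sum>k\<in>{1..<int p}. c k) = (\<Sum>k\<in>{1..<int p}. c 1)"
    by (intro sum.cong refl scale) (auto simp: zdvd_not_zless)
  ultimately have "(real p - 1) * (1 + c 1) = 0" using c0 pos by (simp add: algebra_simps)
  moreover have "real p - 1 \<noteq> 0" using p(1) prime_gt_1_nat by fastforce
  ultimately have "c 1 = -1" by simp
  then show ?thesis using scale[OF assms(3)] by (simp add: c_def)
qed

section \<open>Second moment of the fourfold correlation\<close>

text \<open>By multiplicativity this is the complete sum of the second multiplicative derivative of
  the character, in the directions \<open>s\<close> and \<open>t\<close>. For
  \<open>D = \<Prod>T\<close>, its squares summed over \<open>s\<close> and \<open>t\<close> give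
  \<open>D ^ 4\<close> times the eighth power of the Gowers \<open>U^3\<close> norm.\<close>

definition quad_corr :: "nat set \<Rightarrow> int \<Rightarrow> int \<Rightarrow> real" where
  "quad_corr T s t = (\<Sum>x\<in>{0..<int (\<Prod>T)}. chi T (x * (x + s) * (x + t) * (x + s + t)))"

lemma chi_cong: "[x = y] (mod int (\<Prod>T)) \<Longrightarrow> chi T x = chi T y"
  using mod_periodicD[OF chi_periodic] .

lemma quad_corr_cong:
  assumes "[s = s'] (mod int (\<Prod>T))" "[t = t'] (mod int (\<Prod>T))"
  shows "quad_corr T s t = quad_corr T s' t'"
  unfolding quad_corr_def
  by (intro sum.cong refl chi_cong cong_mult cong_add assms cong_refl)

text \<open>A residue has at most two square roots modulo a prime, and nonnegativity allows the
  nonsquares to be added on the right.\<close>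

lemma sum_le_twice_of_squares:
  fixes G :: "int \<Rightarrow> real"
  assumes p: "prime (p::nat)" and G: "mod_periodic (int p) G" and nn: "\<And>a. G a \<ge> 0"
  shows "(\<Sum>u\<in>{0..<int p}. G (u\<^sup>2)) \<le> 2 * (\<Sum>a\<in>{0..<int p}. G a)"
proof -
  have pos: "int p > 0" using p by (simp add: prime_gt_0_nat)
  have two: "card {u \<in> {0..<int p}. u\<^sup>2 mod int p = a} \<le> 2" for a
  proof (cases "{u \<in> {0..<int p}. u\<^sup>2 mod int p = a} = {}")
    case False
    then obtain u where u: "u \<in> {0..<int p}" "u\<^sup>2 mod int p = a" by blast
    have "{u \<in> {0..<int p}. u\<^sup>2 mod int p = a} \<subseteq> {u, (- u) mod int p}"
    proof
      fix v assume "v \<in> {u \<in> {0..<int p}. u\<^sup>2 mod int p = a}"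
      then have v: "v \<in> {0..<int p}" "v\<^sup>2 mod int p = u\<^sup>2 mod int p" using u by auto
      then have "int p dvd v\<^sup>2 - u\<^sup>2" by (simp add: mod_eq_dvd_iff)
      also have "v\<^sup>2 - u\<^sup>2 = (v - u) * (v - (- u))" by (simp add: power2_eq_square algebra_simps)
      finally have "int p dvd v - u \<or> int p dvd v - (- u)"
        using p by (metis prime_dvd_mult_iff prime_nat_int_transfer)
      then have "v mod int p = u mod int p \<or> v mod int p = (- u) mod int p"
        by (simp only: mod_eq_dvd_iff)
      then show "v \<in> {u, (- u) mod int p}" using u v by auto
    qed
    then have "card {u \<in> {0..<int p}. u\<^sup>2 mod int p = a} \<le> card {u, (- u) mod int p}"
      by (intro card_mono) auto
    also have "\<dots> \<le> 2" by (simp add: card_insert_if)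
    finally show ?thesis .
  next
    case True then show ?thesis by (simp only: True card.empty)
  qed
  have "(\<Sum>u\<in>{0..<int p}. G (u\<^sup>2)) = (\<Sum>u\<in>{0..<int p}. G (u\<^sup>2 mod int p))"
    by (intro sum.cong refl mod_periodicD[OF G]) (simp add: cong_def)
  also have "\<dots> = (\<Sum>a\<in>{0..<int p}. \<Sum>u\<in>{u \<in> {0..<int p}. u\<^sup>2 mod int p = a}. G (u\<^sup>2 mod int p))"
    using pos by (intro sum.group[symmetric]) auto
  also have "\<dots> = (\<Sum>a\<in>{0..<int p}. real (card {u \<in> {0..<int p}. u\<^sup>2 mod int p = a}) * G a)"
    by (intro sum.cong refl) simp
  also have "\<dots> \<le> (\<Sum>a\<in>{0..<int p}. 2 * G a)"
    using two nn by (intro sum_mono mult_right_mono) (auto simp: numeral_le_iff[symmetric] simp del: numeral_le_iff intro: order_trans[OF of_nat_mono])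
  finally show ?thesis by (simp add: sum_distrib_left)
qed

text \<open>With \<open>x = y - u\<close>, \<open>s = u - v\<close>, \<open>t = u + v\<close> the quartic becomes
  \<open>(y\<^sup>2 - u\<^sup>2) (y\<^sup>2 - v\<^sup>2)\<close>; replacing the squares \<open>u\<^sup>2\<close>, \<open>v\<^sup>2\<close> by
  arbitrary residues costs a factor 4 and leaves only correlations of two translates.\<close>
lemma sum_quad_corr_sq_prime:
  assumes p: "prime p" "odd (p::nat)"
  shows "(\<Sum>s\<in>{0..<int p}. \<Sum>t\<in>{0..<int p}. (quad_corr {p} s t)\<^sup>2) \<le> 12 * real p ^ 3"
proof -
  let ?R = "{0..<int p}"
  have op: "odd_primes {p}" using p by (simp add: odd_primes_def)
  have per: "mod_periodic (int p) (chi {p})" using chi_periodic[of "{p}"] by simp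
  have ccong: "chi {p} x = chi {p} y" if "[x = y] (mod int p)" for x y
    using chi_cong[of x y "{p}"] that by simp
  have qcong: "quad_corr {p} s t = quad_corr {p} s' t'"
    if "[s = s'] (mod int p)" "[t = t'] (mod int p)" for s t s' t'
    using quad_corr_cong[of s s' "{p}" t t'] that by simp
  have pos: "int p > 0" using p by (simp add: prime_gt_0_nat)
  define F where "F a b = (\<Sum>y\<in>?R. chi {p} ((y\<^sup>2 - a) * (y\<^sup>2 - b)))" for a b
  have F_cong: "F a b = F a' b'" if "[a = a'] (mod int p)" "[b = b'] (mod int p)" for a b a' b'
    unfolding F_def by (intro sum.cong refl ccong cong_mult cong_diff that cong_refl)
  have Q: "quad_corr {p} (u - v) (u + v) = F (u\<^sup>2) (v\<^sup>2)" for u v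
  proof -
    define h where "h x = chi {p} (x * (x + (u - v)) * (x + (u + v)) * (x + (u - v) + (u + v)))" for x
    have "mod_periodic (int p) h"
      unfolding h_def by (intro mod_periodicI ccong cong_mult cong_add cong_refl)
    then have "(\<Sum>x\<in>?R. h x) = (\<Sum>x\<in>?R. h (x + - u))"
      by (rule sum_periodic_shift[OF pos, symmetric])
    then have "quad_corr {p} (u - v) (u + v) = (\<Sum>x\<in>?R. h (x + - u))"
      by (simp add: quad_corr_def h_def)
    also have "\<dots> = F (u\<^sup>2) (v\<^sup>2)"
      unfolding F_def h_def
      by (intro sum.cong refl arg_cong[of _ _ "chi {p}"]) (simp add: power2_eq_square algebra_simps)
    finally show ?thesis .
  qed
  \<comment> \<open>The substitution \<open>s = u - v\<close>, \<open>t = u + v\<close> is a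
    bijection modulo \<open>p\<close> because 2 is invertible. It is carried out as a translation of
    \<open>u\<close> by \<open>v\<close>, followed by the affine map from \<open>v\<close> to
    \<open>2 * v + u\<close>.\<close>
  have cop2: "coprime 2 (int p)" using p(2) by simp
  have "(\<Sum>u\<in>?R. \<Sum>v\<in>?R. (F (u\<^sup>2) (v\<^sup>2))\<^sup>2)
      = (\<Sum>u\<in>?R. \<Sum>v\<in>?R. (quad_corr {p} (u - v) (u + v))\<^sup>2)" by (simp only: Q)
  also have "\<dots> = (\<Sum>v\<in>?R. \<Sum>u\<in>?R. (quad_corr {p} (u - v) (u + v))\<^sup>2)" by (rule sum.swap)
  also have "\<dots> = (\<Sum>v\<in>?R. \<Sum>u\<in>?R. (quad_corr {p} u (u + 2 * v))\<^sup>2)"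
  proof (rule sum.cong[OF refl])
    fix v
    have "(\<Sum>u\<in>?R. (quad_corr {p} (u - v) (u + v))\<^sup>2)
        = (\<Sum>u\<in>?R. (quad_corr {p} ((u + v) - v) ((u + v) + v))\<^sup>2)"
      by (subst sum_periodic_shift[OF pos, of _ v, symmetric])
        (auto intro!: mod_periodicI arg_cong[of _ _ "\<lambda>x. x\<^sup>2"] qcong cong_add cong_diff cong_refl)
    then show "(\<Sum>u\<in>?R. (quad_corr {p} (u - v) (u + v))\<^sup>2) = (\<Sum>u\<in>?R. (quad_corr {p} u (u + 2 * v))\<^sup>2)"
      by (simp add: algebra_simps)
  qed
  also have "\<dots> = (\<Sum>u\<in>?R. \<Sum>v\<in>?R. (quad_corr {p} u (2 * v + u))\<^sup>2)"
    by (subst sum.swap) (simp add: add.commute)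
  also have "\<dots> = (\<Sum>u\<in>?R. \<Sum>v\<in>?R. (quad_corr {p} u v)\<^sup>2)"
  proof (rule sum.cong[OF refl])
    fix u
    have "mod_periodic (int p) (\<lambda>v. (quad_corr {p} u v)\<^sup>2)"
      by (auto intro!: mod_periodicI arg_cong[of _ _ "\<lambda>x. x\<^sup>2"] qcong cong_refl)
    then show "(\<Sum>v\<in>?R. (quad_corr {p} u (2 * v + u))\<^sup>2) = (\<Sum>v\<in>?R. (quad_corr {p} u v)\<^sup>2)"
      by (rule sum_periodic_affine[OF pos cop2])
  qed
  finally have lhs: "(\<Sum>s\<in>?R. \<Sum>t\<in>?R. (quad_corr {p} s t)\<^sup>2) = (\<Sum>u\<in>?R. \<Sum>v\<in>?R. (F (u\<^sup>2) (v\<^sup>2))\<^sup>2)" by simp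
  have "(\<Sum>u\<in>?R. \<Sum>v\<in>?R. (F (u\<^sup>2) (v\<^sup>2))\<^sup>2) \<le> (\<Sum>u\<in>?R. 2 * (\<Sum>b\<in>?R. (F (u\<^sup>2) b)\<^sup>2))"
    by (intro sum_mono sum_le_twice_of_squares[OF p(1)])
      (auto intro!: mod_periodicI arg_cong[of _ _ "\<lambda>x. x\<^sup>2"] F_cong cong_refl)
  also have "\<dots> \<le> 2 * (\<Sum>a\<in>?R. 2 * (\<Sum>b\<in>?R. (F a b)\<^sup>2))"
    by (intro sum_le_twice_of_squares[OF p(1)])
      (auto intro!: mod_periodicI sum.cong arg_cong[of _ _ "\<lambda>x. 2 * (x::real)"] arg_cong[of _ _ "\<lambda>x. x\<^sup>2"] F_cong cong_refl sum_nonneg)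
  also have "\<dots> = 4 * (\<Sum>a\<in>?R. \<Sum>b\<in>?R. (F a b)\<^sup>2)" by (simp add: sum_distrib_left)
  finally have le4: "(\<Sum>u\<in>?R. \<Sum>v\<in>?R. (F (u\<^sup>2) (v\<^sup>2))\<^sup>2) \<le> 4 * (\<Sum>a\<in>?R. \<Sum>b\<in>?R. (F a b)\<^sup>2)" .
  \<comment> \<open>Expanding the square and summing over \<open>a\<close> and \<open>b\<close>
    first leaves only the two-point correlation \<open>c\<close>. It is at most \<open>p\<close> in
    size on the at most \<open>2 * p\<close> pairs with \<open>y\<^sup>2 = z\<^sup>2\<close> modulo
    \<open>p\<close> and equals -1 elsewhere, so the total is at most
    \<open>2 * p ^ 3 + p\<^sup>2\<close>, hence at most \<open>3 * p ^ 3\<close>. With the factor 4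
    for the squares this makes 12.\<close>
  define c where "c y z = (\<Sum>a\<in>?R. chi {p} (y\<^sup>2 - a) * chi {p} (z\<^sup>2 - a))" for y z
  have "(\<Sum>a\<in>?R. \<Sum>b\<in>?R. (F a b)\<^sup>2)
      = (\<Sum>a\<in>?R. \<Sum>b\<in>?R. \<Sum>y\<in>?R. \<Sum>z\<in>?R. (chi {p} (y\<^sup>2 - a) * chi {p} (z\<^sup>2 - a)) * (chi {p} (y\<^sup>2 - b) * chi {p} (z\<^sup>2 - b)))"
    unfolding F_def power2_eq_square[of "sum _ _"] sum_product
    by (simp add: chi_mult[OF op] mult_ac)
  also have "\<dots> = (\<Sum>y\<in>?R. \<Sum>z\<in>?R. \<Sum>a\<in>?R. \<Sum>b\<in>?R. (chi {p} (y\<^sup>2 - a) * chi {p} (z\<^sup>2 - a)) * (chi {p} (y\<^sup>2 - b) * chi {p} (z\<^sup>2 - b)))"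
  proof -
    have "(\<Sum>a\<in>?R. \<Sum>b\<in>?R. \<Sum>y\<in>?R. \<Sum>z\<in>?R. f a b y z) = (\<Sum>y\<in>?R. \<Sum>z\<in>?R. \<Sum>a\<in>?R. \<Sum>b\<in>?R. f a b y z)"
      for f :: "int \<Rightarrow> int \<Rightarrow> int \<Rightarrow> int \<Rightarrow> real"
    proof -
      have "(\<Sum>a\<in>?R. \<Sum>b\<in>?R. \<Sum>y\<in>?R. \<Sum>z\<in>?R. f a b y z) = (\<Sum>a\<in>?R. \<Sum>y\<in>?R. \<Sum>b\<in>?R. \<Sum>z\<in>?R. f a b y z)"
        by (intro sum.cong refl sum.swap)
      also have "\<dots> = (\<Sum>y\<in>?R. \<Sum>a\<in>?R. \<Sum>b\<in>?R. \<Sum>z\<in>?R. f a b y z)" by (rule sum.swap)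
      also have "\<dots> = (\<Sum>y\<in>?R. \<Sum>a\<in>?R. \<Sum>z\<in>?R. \<Sum>b\<in>?R. f a b y z)"
        by (intro sum.cong refl sum.swap)
      also have "\<dots> = (\<Sum>y\<in>?R. \<Sum>z\<in>?R. \<Sum>a\<in>?R. \<Sum>b\<in>?R. f a b y z)"
        by (intro sum.cong refl sum.swap)
      finally show ?thesis .
    qed
    then show ?thesis .
  qed
  also have "\<dots> = (\<Sum>y\<in>?R. \<Sum>z\<in>?R. (c y z)\<^sup>2)"
    by (simp add: c_def power2_eq_square[of "sum _ _"] sum_product)
  also have "\<dots> \<le> (\<Sum>y\<in>?R. \<Sum>z\<in>?R. (real p)\<^sup>2 * of_bool (z\<^sup>2 mod int p = y\<^sup>2 mod int p) + 1)"
  proof (intro sum_mono)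
    fix y z
    show "(c y z)\<^sup>2 \<le> (real p)\<^sup>2 * of_bool (z\<^sup>2 mod int p = y\<^sup>2 mod int p) + 1"
    proof (cases "z\<^sup>2 mod int p = y\<^sup>2 mod int p")
      case True
      have "\<bar>c y z\<bar> \<le> (\<Sum>a\<in>?R. 1)"
        unfolding c_def
        by (intro order_trans[OF sum_abs] sum_mono)
          (auto simp: abs_mult intro!: mult_le_one abs_chi_le)
      then have "\<bar>c y z\<bar> \<le> \<bar>real p\<bar>" by simp
      then show ?thesis using True abs_le_square_iff[of "c y z" "real p"] by simp
    next
      case False
      then have nd: "\<not> int p dvd z\<^sup>2 - y\<^sup>2" by (simp add: mod_eq_dvd_iff)
      define f where "f x = chi {p} x * chi {p} (x + (z\<^sup>2 - y\<^sup>2))" for x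
      have fper: "mod_periodic (int p) f"
        unfolding f_def
        by (auto intro!: mod_periodicI arg_cong2[of _ _ _ _ "(*)"] ccong simp: cong_add_rcancel)
      have "c y z = (\<Sum>a\<in>?R. f ((-1) * a + y\<^sup>2))"
        by (simp add: c_def f_def)
      also have "\<dots> = (\<Sum>a\<in>?R. f a)" by (rule sum_periodic_affine[OF pos _ fper]) simp
      also have "\<dots> = -1" unfolding f_def by (rule chi_correlation_prime[OF p nd])
      finally show ?thesis using False by simp
    qed
  qed
  also have "\<dots> = (real p)\<^sup>2 * (\<Sum>y\<in>?R. \<Sum>z\<in>?R. of_bool (z\<^sup>2 mod int p = y\<^sup>2 mod int p)) + (real p)\<^sup>2"
    by (simp add: sum.distrib sum_distrib_left power2_eq_square mult.commute)
  also have "(\<Sum>y\<in>?R. \<Sum>z\<in>?R. of_bool (z\<^sup>2 mod int p = y\<^sup>2 mod int p)) \<le> (\<Sum>y\<in>?R. 2 :: real)"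
  proof (intro sum_mono)
    fix y
    have "(\<Sum>z\<in>?R. of_bool (z\<^sup>2 mod int p = y\<^sup>2 mod int p) :: real)
       \<le> 2 * (\<Sum>a\<in>?R. of_bool (a mod int p = y\<^sup>2 mod int p))"
      by (rule sum_le_twice_of_squares[OF p(1), where G = "\<lambda>a. of_bool (a mod int p = y\<^sup>2 mod int p)"])
        (auto intro!: mod_periodicI simp: cong_def)
    also have "(\<Sum>a\<in>?R. of_bool (a mod int p = y\<^sup>2 mod int p) :: real) = (\<Sum>a\<in>?R. if a = y\<^sup>2 mod int p then 1 else 0)"
      by (intro sum.cong refl) (auto)
    also have "\<dots> = 1" using pos by (simp add: sum.delta)
    finally show "(\<Sum>z\<in>?R. of_bool (z\<^sup>2 mod int p = y\<^sup>2 mod int p) :: real) \<le> 2" by simp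
  qed
  also have "(\<Sum>y\<in>?R. 2 :: real) = 2 * real p" by simp
  finally have "(\<Sum>a\<in>?R. \<Sum>b\<in>?R. (F a b)\<^sup>2) \<le> (real p)\<^sup>2 * (2 * real p) + (real p)\<^sup>2"
    by (simp add: mult_left_mono)
  also have "\<dots> \<le> 3 * real p ^ 3"
  proof -
    have "(real p)\<^sup>2 * 1 \<le> (real p)\<^sup>2 * real p" using pos by (intro mult_left_mono) auto
    then show ?thesis by (simp add: power2_eq_square power3_eq_cube)
  qed
  finally show ?thesis using lhs le4 by linarith
qed

lemma quad_corr_insert:
  assumes T: "odd_primes (insert p T)" "p \<notin> T"
  shows "quad_corr (insert p T) s t = quad_corr {p} s t * quad_corr T s t"
proof -
  have op: "odd_primes {p}" "odd_primes T" using T odd_primes_subset[OF T(1)] by auto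
  have fin: "finite T" using op by (simp add: odd_primes_def)
  have pr: "\<Prod>(insert p T) = p * \<Prod>T" using T(2) fin by simp
  have "int (\<Prod>{p}) > 0" "int (\<Prod>T) > 0" "coprime (int (\<Prod>{p})) (int (\<Prod>T))"
    using odd_primes_prod_pos[OF op(1)] odd_primes_prod_pos[OF op(2)]
      coprime_prod_disjoint[OF op] T(2) by (auto simp del: of_nat_prod)
  then show ?thesis
    unfolding quad_corr_def pr chi_insert[OF fin T(2)]
    by (subst sum_periodic_mult_coprime[symmetric])
      (auto simp del: of_nat_prod intro!: mod_periodicI chi_cong cong_mult cong_add cong_refl)
qed

text \<open>The double sum is multiplicative over the primes of \<open>T\<close>, so every prime
  contributes one factor 12. Compared with the trivial bound \<open>D ^ 4\<close>, where
  \<open>D = \<Prod>T\<close>, a full factor \<open>D\<close> is saved up to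
  \<open>12 ^ card T\<close>.\<close>

lemma sum_quad_corr_sq:
  assumes "odd_primes T"
  shows "(\<Sum>s\<in>{0..<int (\<Prod>T)}. \<Sum>t\<in>{0..<int (\<Prod>T)}. (quad_corr T s t)\<^sup>2)
     \<le> 12 ^ card T * real (\<Prod>T) ^ 3"
proof -
  have "finite T" using assms by (simp add: odd_primes_def)
  then show ?thesis using assms
  proof (induction T rule: finite_induct)
    case empty
    have "{0..<1::int} = {0}" by auto
    then show ?case by (simp add: quad_corr_def)
  next
    case (insert p T)
    have op: "odd_primes {p}" "odd_primes T" using odd_primes_subset[OF insert.prems] by auto
    have p: "prime p" "odd p" using op by (auto simp: odd_primes_def)
    define D where "D = int (\<Prod>T)"
    have pr: "int (\<Prod>(insert p T)) = int p * D" using insert.hyps by (simp add: D_def)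
    have pD: "int p > 0" "D > 0" "coprime (int p) D"
      using odd_primes_prod_pos[OF op(1)] odd_primes_prod_pos[OF op(2)]
        coprime_prod_disjoint[OF op] insert.hyps by (auto simp: D_def simp del: of_nat_prod)
    have c1: "quad_corr {p} s t = quad_corr {p} s' t'"
      if "[s = s'] (mod int p)" "[t = t'] (mod int p)" for s t s' t'
      using quad_corr_cong[of s s' "{p}" t t'] that by simp
    have c2: "quad_corr T s t = quad_corr T s' t'"
      if "[s = s'] (mod D)" "[t = t'] (mod D)" for s t s' t'
      using quad_corr_cong[of s s' T t t'] that by (simp add: D_def)
    note pI = mod_periodicI arg_cong[of _ _ "\<lambda>x. x\<^sup>2"] c1 c2 cong_refl sum.cong
    have "(\<Sum>s\<in>{0..<int p * D}. \<Sum>t\<in>{0..<int p * D}. (quad_corr (insert p T) s t)\<^sup>2)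
       = (\<Sum>s\<in>{0..<int p * D}. \<Sum>t\<in>{0..<int p * D}. (quad_corr {p} s t)\<^sup>2 * (quad_corr T s t)\<^sup>2)"
      by (simp only: quad_corr_insert[OF insert.prems insert.hyps(2)] power_mult_distrib)
    also have "\<dots> = (\<Sum>s\<in>{0..<int p * D}. (\<Sum>t\<in>{0..<int p}. (quad_corr {p} s t)\<^sup>2) * (\<Sum>t\<in>{0..<D}. (quad_corr T s t)\<^sup>2))"
      by (intro sum.cong refl sum_periodic_mult_coprime pD) (auto intro!: pI)
    also have "\<dots> = (\<Sum>s\<in>{0..<int p}. \<Sum>t\<in>{0..<int p}. (quad_corr {p} s t)\<^sup>2) * (\<Sum>s\<in>{0..<D}. \<Sum>t\<in>{0..<D}. (quad_corr T s t)\<^sup>2)"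
      by (intro sum_periodic_mult_coprime pD) (auto intro!: pI)
    also have "\<dots> \<le> (12 * real p ^ 3) * (12 ^ card T * real (\<Prod>T) ^ 3)"
      using insert.IH[OF op(2)] sum_quad_corr_sq_prime[OF p]
      by (intro mult_mono) (auto simp: D_def simp del: of_nat_prod intro!: sum_nonneg)
    also have "\<dots> = 12 ^ card (insert p T) * real (\<Prod>(insert p T)) ^ 3"
      using insert.hyps by (simp add: power_mult_distrib)
    finally show ?case by (simp only: pr)
  qed
qed

section \<open>Character sums to smooth moduli\<close>

lemma sum_bounded_weight_sq:
  fixes a g :: "'a \<Rightarrow> real"
  assumes "\<And>x. \<bar>a x\<bar> \<le> 1"
  shows "(\<Sum>x\<in>R. a x * g x)\<^sup>2 \<le> real (card R) * (\<Sum>x\<in>R. (g x)\<^sup>2)"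
proof -
  have "(\<Sum>x\<in>R. a x * g x)\<^sup>2 \<le> (\<Sum>x\<in>R. (a x * g x)\<^sup>2) * real (card R)"
    by (rule sum_squared_le_sum_of_squares)
  also have "\<dots> \<le> (\<Sum>x\<in>R. (g x)\<^sup>2) * real (card R)"
  proof (intro mult_right_mono sum_mono)
    fix x
    have "(a x)\<^sup>2 \<le> 1" using assms[of x] by (simp add: abs_square_le_1)
    then show "(a x * g x)\<^sup>2 \<le> (g x)\<^sup>2"
      using mult_right_mono[of "(a x)\<^sup>2" 1 "(g x)\<^sup>2"] by (simp add: power_mult_distrib)
  qed simp
  finally show ?thesis by (simp add: mult.commute)
qed

text \<open>Cauchy-Schwarz in \<open>x\<close> removes \<open>a\<close> and duplicates
  \<open>y\<close>. The weights \<open>b y * b y'\<close> are then constant in the inner sum and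
  disappear in the absolute value without a second squaring.\<close>

lemma box_norm_2:
  fixes a b :: "'a \<Rightarrow> real" and g :: "'a \<Rightarrow> 'a \<Rightarrow> real"
  assumes a: "\<And>x. \<bar>a x\<bar> \<le> 1" and b: "\<And>x. \<bar>b x\<bar> \<le> 1"
  shows "(\<Sum>x\<in>R. \<Sum>y\<in>R. a x * b y * g x y)\<^sup>2
    \<le> real (card R) * (\<Sum>y\<in>R. \<Sum>y'\<in>R. \<bar>\<Sum>x\<in>R. g x y * g x y'\<bar>)"
proof -
  have "(\<Sum>x\<in>R. \<Sum>y\<in>R. a x * b y * g x y)\<^sup>2 = (\<Sum>x\<in>R. a x * (\<Sum>y\<in>R. b y * g x y))\<^sup>2"
    by (simp add: sum_distrib_left mult.assoc)
  also have "\<dots> \<le> real (card R) * (\<Sum>x\<in>R. (\<Sum>y\<in>R. b y * g x y)\<^sup>2)"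
    by (rule sum_bounded_weight_sq[OF a])
  also have "(\<Sum>x\<in>R. (\<Sum>y\<in>R. b y * g x y)\<^sup>2)
      = (\<Sum>x\<in>R. \<Sum>y\<in>R. \<Sum>y'\<in>R. (b y * b y') * (g x y * g x y'))"
    by (simp add: power2_eq_square sum_product mult_ac)
  also have "\<dots> = (\<Sum>y\<in>R. \<Sum>x\<in>R. \<Sum>y'\<in>R. (b y * b y') * (g x y * g x y'))" by (rule sum.swap)
  also have "\<dots> = (\<Sum>y\<in>R. \<Sum>y'\<in>R. (b y * b y') * (\<Sum>x\<in>R. g x y * g x y'))"
    unfolding sum_distrib_left by (rule sum.cong[OF refl], rule sum.swap)
  also have "\<dots> \<le> (\<Sum>y\<in>R. \<Sum>y'\<in>R. \<bar>\<Sum>x\<in>R. g x y * g x y'\<bar>)"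
  proof (intro sum_mono)
    fix y y'
    have "(b y * b y') * (\<Sum>x\<in>R. g x y * g x y') \<le> \<bar>b y * b y'\<bar> * \<bar>\<Sum>x\<in>R. g x y * g x y'\<bar>"
      by (metis abs_ge_self abs_mult)
    also have "\<dots> \<le> 1 * \<bar>\<Sum>x\<in>R. g x y * g x y'\<bar>"
      using b by (intro mult_right_mono) (auto simp: abs_mult intro!: mult_le_one)
    finally show "(b y * b y') * (\<Sum>x\<in>R. g x y * g x y') \<le> \<bar>\<Sum>x\<in>R. g x y * g x y'\<bar>" by simp
  qed
  finally show ?thesis by (simp add: mult_left_mono)
qed

text \<open>Cauchy--Schwarz is applied to \<open>(x, y)\<close>, to \<open>x\<close> and to what is left, each time removing
  one weight, as in the proof of the Gowers--Cauchy--Schwarz inequality for the \<open>U\<^sup>3\<close> norm.\<close>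
lemma box_norm_3:
  fixes a b c :: "'a \<Rightarrow> 'a \<Rightarrow> real" and F :: "'a \<Rightarrow> 'a \<Rightarrow> 'a \<Rightarrow> real"
  assumes a: "\<And>x y. \<bar>a x y\<bar> \<le> 1" and b: "\<And>x y. \<bar>b x y\<bar> \<le> 1" and c: "\<And>x y. \<bar>c x y\<bar> \<le> 1"
  shows "(\<Sum>x\<in>R. \<Sum>y\<in>R. \<Sum>z\<in>R. a x y * b x z * c y z * F x y z) ^ 8
    \<le> real (card R) ^ 18 * (\<Sum>z\<in>R. \<Sum>z'\<in>R. \<Sum>y\<in>R. \<Sum>y'\<in>R.
        (\<Sum>x\<in>R. F x y z * F x y z' * (F x y' z * F x y' z'))\<^sup>2)"
proof -
  define N where "N = real (card R)"
  have N0: "N \<ge> 0" by (simp add: N_def)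
  define W where "W = (\<Sum>x\<in>R. \<Sum>y\<in>R. \<Sum>z\<in>R. a x y * b x z * c y z * F x y z)"
  define V where "V z z' = (\<Sum>x\<in>R. \<Sum>y\<in>R. (b x z * b x z') * (c y z * c y z') * (F x y z * F x y z'))" for z z'
  define E where "E z z' y y' = (\<Sum>x\<in>R. F x y z * F x y z' * (F x y' z * F x y' z'))" for z z' y y'
  have "W = (\<Sum>(x, y)\<in>R \<times> R. a x y * (\<Sum>z\<in>R. b x z * c y z * F x y z))"
    unfolding W_def by (simp only: sum_distrib_left mult.assoc) (rule sum.cartesian_product)
  then have "W = (\<Sum>w\<in>R \<times> R. a (fst w) (snd w) * (\<Sum>z\<in>R. b (fst w) z * c (snd w) z * F (fst w) (snd w) z))"
    by (simp add: case_prod_beta)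
  then have "W\<^sup>2 \<le> real (card (R \<times> R)) * (\<Sum>w\<in>R \<times> R. (\<Sum>z\<in>R. b (fst w) z * c (snd w) z * F (fst w) (snd w) z)\<^sup>2)"
    by (simp only:) (rule sum_bounded_weight_sq, rule a)
  also have "real (card (R \<times> R)) = N\<^sup>2" by (simp add: N_def card_cartesian_product power2_eq_square)
  also have "(\<Sum>w\<in>R \<times> R. (\<Sum>z\<in>R. b (fst w) z * c (snd w) z * F (fst w) (snd w) z)\<^sup>2)
      = (\<Sum>w\<in>R \<times> R. \<Sum>z\<in>R. \<Sum>z'\<in>R. (b (fst w) z * b (fst w) z') * (c (snd w) z * c (snd w) z') * (F (fst w) (snd w) z * F (fst w) (snd w) z'))"
    by (simp add: power2_eq_square sum_product mult_ac)
  also have "\<dots> = (\<Sum>z\<in>R. \<Sum>w\<in>R \<times> R. \<Sum>z'\<in>R. (b (fst w) z * b (fst w) z') * (c (snd w) z * c (snd w) z') * (F (fst w) (snd w) z * F (fst w) (snd w) z'))"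
    by (rule sum.swap)
  also have "\<dots> = (\<Sum>z\<in>R. \<Sum>z'\<in>R. V z z')"
    by (rule sum.cong[OF refl], subst sum.swap) (simp add: V_def sum.cartesian_product case_prod_beta)
  finally have W2: "W\<^sup>2 \<le> N\<^sup>2 * (\<Sum>z\<in>R. \<Sum>z'\<in>R. V z z')" .
  \<comment> \<open>For fixed \<open>z\<close> and \<open>z'\<close> the doubled weights depend on
    \<open>x\<close> alone and on \<open>y\<close> alone, so that \<open>box_norm_2\<close> removes
    both.\<close>
  have bb: "\<bar>b x z * b x z'\<bar> \<le> 1" "\<bar>c x z * c x z'\<bar> \<le> 1" for x z z'
    using b c by (auto simp: abs_mult intro!: mult_le_one)
  have V2: "(V z z')\<^sup>2 \<le> N * (\<Sum>y\<in>R. \<Sum>y'\<in>R. \<bar>E z z' y y'\<bar>)" for z z'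
    unfolding V_def N_def E_def by (rule box_norm_2) (rule bb)+
  have sq2: "(\<Sum>x\<in>R. \<Sum>y\<in>R. f x y)\<^sup>2 \<le> N\<^sup>2 * (\<Sum>x\<in>R. \<Sum>y\<in>R. (f x y)\<^sup>2)" for f :: "'a \<Rightarrow> 'a \<Rightarrow> real"
    using sum_squared_le_sum_of_squares[of "\<lambda>w. f (fst w) (snd w)" "R \<times> R"]
    by (simp add: sum.cartesian_product case_prod_beta N_def card_cartesian_product power2_eq_square mult_ac)
  have "W ^ 4 = (W\<^sup>2)\<^sup>2" by simp
  also have "\<dots> \<le> (N\<^sup>2 * (\<Sum>z\<in>R. \<Sum>z'\<in>R. V z z'))\<^sup>2" by (rule power_mono[OF W2]) simp
  also have "\<dots> = N ^ 4 * (\<Sum>z\<in>R. \<Sum>z'\<in>R. V z z')\<^sup>2" by (simp add: power_mult_distrib)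
  also have "\<dots> \<le> N ^ 4 * (N\<^sup>2 * (\<Sum>z\<in>R. \<Sum>z'\<in>R. (V z z')\<^sup>2))"
    by (intro mult_left_mono sq2) simp
  also have "\<dots> \<le> N ^ 4 * (N\<^sup>2 * (\<Sum>z\<in>R. \<Sum>z'\<in>R. N * (\<Sum>y\<in>R. \<Sum>y'\<in>R. \<bar>E z z' y y'\<bar>)))"
    by (intro mult_left_mono sum_mono V2) auto
  also have "\<dots> = N ^ 7 * (\<Sum>z\<in>R. \<Sum>z'\<in>R. \<Sum>y\<in>R. \<Sum>y'\<in>R. \<bar>E z z' y y'\<bar>)"
    by (simp add: sum_distrib_left[symmetric]) (simp add: eval_nat_numeral)
  finally have W4: "W ^ 4 \<le> N ^ 7 * (\<Sum>z\<in>R. \<Sum>z'\<in>R. \<Sum>y\<in>R. \<Sum>y'\<in>R. \<bar>E z z' y y'\<bar>)" .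
  \<comment> \<open>This last squaring only turns the absolute values into squares, the form of the
    \<open>U^3\<close> norm. The quadruple sum has \<open>N ^ 4\<close> terms, which makes the final
    exponent \<open>14 + 4\<close>.\<close>
  have "W ^ 8 = (W ^ 4)\<^sup>2" by simp
  also have "\<dots> \<le> (N ^ 7 * (\<Sum>z\<in>R. \<Sum>z'\<in>R. \<Sum>y\<in>R. \<Sum>y'\<in>R. \<bar>E z z' y y'\<bar>))\<^sup>2"
    by (rule power_mono[OF W4]) simp
  also have "\<dots> = N ^ 14 * (\<Sum>z\<in>R. \<Sum>z'\<in>R. \<Sum>y\<in>R. \<Sum>y'\<in>R. \<bar>E z z' y y'\<bar>)\<^sup>2"
    by (simp add: power_mult_distrib)
  also have "\<dots> \<le> N ^ 14 * (N\<^sup>2 * (\<Sum>z\<in>R. \<Sum>z'\<in>R. (\<Sum>y\<in>R. \<Sum>y'\<in>R. \<bar>E z z' y y'\<bar>)\<^sup>2))"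
    using N0 by (intro mult_left_mono sq2) simp
  also have "\<dots> \<le> N ^ 14 * (N\<^sup>2 * (\<Sum>z\<in>R. \<Sum>z'\<in>R. N\<^sup>2 * (\<Sum>y\<in>R. \<Sum>y'\<in>R. \<bar>E z z' y y'\<bar>\<^sup>2)))"
    using N0 by (intro mult_left_mono sum_mono sq2) auto
  also have "\<dots> = N ^ 18 * (\<Sum>z\<in>R. \<Sum>z'\<in>R. \<Sum>y\<in>R. \<Sum>y'\<in>R. (E z z' y y')\<^sup>2)"
    by (simp add: sum_distrib_left[symmetric])
  finally show ?thesis by (simp only: W_def E_def N_def)
qed

text \<open>In \<open>box_norm_3\<close> the inner sum over \<open>x\<close> is complete, and since
  \<open>d3\<close> is a unit it equals the fourfold correlation at \<open>s = d1 * (z' - z)\<close>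
  and \<open>t = d2 * (y' - y)\<close>. As \<open>d1\<close> and \<open>d2\<close> are units too,
  each pair \<open>(s, t)\<close> occurs \<open>D\<^sup>2\<close> times. The right-hand side becomes
  \<open>D ^ 18 * D\<^sup>2 * 12 ^ card T * D ^ 3\<close>, that is, the eighth power of the trivial
  bound \<open>D ^ 3\<close> times \<open>12 ^ card T / D\<close>.\<close>

lemma box_character_sum:
  assumes T: "odd_primes T" and cop: "coprime d1 (int (\<Prod>T))" "coprime d2 (int (\<Prod>T))" "coprime d3 (int (\<Prod>T))"
    and a: "\<And>x y. \<bar>a x y\<bar> \<le> 1" and b: "\<And>x y. \<bar>b x y\<bar> \<le> 1" and c: "\<And>x y. \<bar>c x y\<bar> \<le> 1"
  defines "R \<equiv> {0..<int (\<Prod>T)}"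
  shows "\<bar>\<Sum>x\<in>R. \<Sum>y\<in>R. \<Sum>z\<in>R. a x y * b x z * c y z * chi T (n + d1 * z + d2 * y + d3 * x)\<bar>
    \<le> real (\<Prod>T) ^ 3 * (12 ^ card T / real (\<Prod>T)) powr (1/8)"
proof -
  define D where "D = int (\<Prod>T)"
  define F where "F x y z = chi T (n + d1 * z + d2 * y + d3 * x)" for x y z
  define W where "W = (\<Sum>x\<in>R. \<Sum>y\<in>R. \<Sum>z\<in>R. a x y * b x z * c y z * F x y z)"
  have D: "D > 0" using odd_primes_prod_pos[OF T] by (simp add: D_def del: of_nat_prod)
  have R: "R = {0..<D}" by (simp add: R_def D_def)
  have rD: "real (\<Prod>T) = real_of_int D" by (simp add: D_def)
  have cardR: "real (card R) = real_of_int D" using D by (simp add: R)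
  have cop': "coprime d1 D" "coprime d2 D" "coprime d3 D" using cop by (simp_all add: D_def)
  have ccong: "chi T x = chi T y" if "[x = y] (mod D)" for x y
    using that chi_cong D_def by simp
  have qcong: "quad_corr T s t = quad_corr T s' t'" if "[s = s'] (mod D)" "[t = t'] (mod D)" for s t s' t'
    using that quad_corr_cong D_def by simp
  have E: "(\<Sum>x\<in>R. F x y z * F x y z' * (F x y' z * F x y' z')) = quad_corr T (d1 * (z' - z)) (d2 * (y' - y))"
    for y y' z z'
  proof -
    define s where "s = d1 * (z' - z)"
    define t where "t = d2 * (y' - y)"
    define h where "h x = chi T (x * (x + s) * (x + t) * (x + s + t))" for x
    have h: "mod_periodic D h"
      unfolding h_def by (intro mod_periodicI ccong cong_mult cong_add cong_refl)
    have "F x y z * F x y z' * (F x y' z * F x y' z') = h (d3 * x + (n + d1 * z + d2 * y))" for x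
    proof -
      define w where "w = d3 * x + (n + d1 * z + d2 * y)"
      have "n + d1 * z + d2 * y + d3 * x = w" "n + d1 * z' + d2 * y + d3 * x = w + s"
        "n + d1 * z + d2 * y' + d3 * x = w + t" "n + d1 * z' + d2 * y' + d3 * x = w + s + t"
        by (simp_all add: w_def s_def t_def algebra_simps)
      then show ?thesis
        by (simp only: F_def h_def w_def[symmetric] chi_mult[OF T] mult.assoc)
    qed
    then have "(\<Sum>x\<in>R. F x y z * F x y z' * (F x y' z * F x y' z')) = (\<Sum>x\<in>R. h (d3 * x + (n + d1 * z + d2 * y)))"
      by simp
    also have "\<dots> = (\<Sum>x\<in>R. h x)" unfolding R by (rule sum_periodic_affine[OF D cop'(3) h])
    also have "\<dots> = quad_corr T s t" by (simp only: quad_corr_def h_def R_def)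
    finally show ?thesis by (simp only: s_def t_def)
  qed
  have inner: "(\<Sum>y'\<in>R. (quad_corr T s (d2 * (y' - y)))\<^sup>2) = (\<Sum>t\<in>R. (quad_corr T s t)\<^sup>2)" for s y
  proof -
    have "mod_periodic D (\<lambda>t. (quad_corr T s t)\<^sup>2)"
      by (auto intro!: mod_periodicI arg_cong[of _ _ "\<lambda>x. x\<^sup>2"] qcong cong_refl)
    from sum_periodic_affine[OF D cop'(2) this, of "- d2 * y"] show ?thesis
      by (simp add: R algebra_simps)
  qed
  have outer: "(\<Sum>z'\<in>R. \<Sum>t\<in>R. (quad_corr T (d1 * (z' - z)) t)\<^sup>2) = (\<Sum>s\<in>R. \<Sum>t\<in>R. (quad_corr T s t)\<^sup>2)" for z
  proof -
    have "mod_periodic D (\<lambda>s. \<Sum>t\<in>R. (quad_corr T s t)\<^sup>2)"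
      by (auto intro!: mod_periodicI sum.cong arg_cong[of _ _ "\<lambda>x. x\<^sup>2"] qcong cong_refl)
    from sum_periodic_affine[OF D cop'(1) this, of "- d1 * z"] show ?thesis
      by (simp add: R algebra_simps)
  qed
  have q: "(\<Sum>s\<in>R. \<Sum>t\<in>R. (quad_corr T s t)\<^sup>2) \<le> 12 ^ card T * real_of_int D ^ 3"
    using sum_quad_corr_sq[OF T] by (simp only: R_def rD)
  have "W ^ 8 \<le> real (card R) ^ 18 * (\<Sum>z\<in>R. \<Sum>z'\<in>R. \<Sum>y\<in>R. \<Sum>y'\<in>R.
      (\<Sum>x\<in>R. F x y z * F x y z' * (F x y' z * F x y' z'))\<^sup>2)"
    unfolding W_def by (rule box_norm_3[OF a b c])
  also have "(\<Sum>z\<in>R. \<Sum>z'\<in>R. \<Sum>y\<in>R. \<Sum>y'\<in>R. (\<Sum>x\<in>R. F x y z * F x y z' * (F x y' z * F x y' z'))\<^sup>2)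
      = (\<Sum>z\<in>R. \<Sum>z'\<in>R. \<Sum>y\<in>R. \<Sum>t\<in>R. (quad_corr T (d1 * (z' - z)) t)\<^sup>2)"
    by (simp only: E inner)
  also have "\<dots> = D\<^sup>2 * (\<Sum>s\<in>R. \<Sum>t\<in>R. (quad_corr T s t)\<^sup>2)"
    by (simp add: outer cardR sum_distrib_left[symmetric]) (simp add: power2_eq_square)
  also have "real (card R) ^ 18 * \<dots> \<le> D ^ 18 * (D\<^sup>2 * (12 ^ card T * real_of_int D ^ 3))"
    unfolding cardR of_int_power using q D by (intro mult_left_mono) auto
  also have "\<dots> = (D ^ 3) ^ 8 * (12 ^ card T / D)"
    using D by (simp add: field_simps) (simp add: eval_nat_numeral)
  finally have W8: "W ^ 8 \<le> (D ^ 3) ^ 8 * (12 ^ card T / D)" .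
  have "(\<bar>W\<bar> / D ^ 3) ^ 8 \<le> 12 ^ card T / D"
    using W8 D by (simp add: power_divide divide_le_eq power_even_abs_numeral mult.commute)
  then have "((\<bar>W\<bar> / D ^ 3) ^ 8) powr (1/8) \<le> (12 ^ card T / D) powr (1/8)"
    using D by (intro powr_mono2) auto
  moreover have "((\<bar>W\<bar> / D ^ 3) ^ 8) powr (1/8) = \<bar>W\<bar> / D ^ 3"
    using D by (cases "W = 0") (simp_all add: powr_powr flip: powr_numeral)
  ultimately have "\<bar>W\<bar> \<le> D ^ 3 * (12 ^ card T / D) powr (1/8)"
    using D by (simp add: divide_le_eq mult.commute)
  then show ?thesis by (simp only: W_def F_def rD of_int_power)
qed

section \<open>From averages over translations to short sums\<close>

lemma sum_translate_bound:
  fixes f :: "int \<Rightarrow> real"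
  assumes f: "\<And>n. \<bar>f n\<bar> \<le> 1" and k: "k \<ge> 0"
  shows "\<bar>(\<Sum>n\<in>{1..L}. f n) - (\<Sum>n\<in>{1..L}. f (n + k))\<bar> \<le> 2 * k"
proof -
  have "(\<Sum>n\<in>{1..L}. f (n + k)) = (\<Sum>n\<in>{1 + k..L + k}. f n)"
    by (rule sum.reindex_bij_witness[of _ "\<lambda>n. n - k" "\<lambda>n. n + k"]) auto
  then have "(\<Sum>n\<in>{1..L}. f n) - (\<Sum>n\<in>{1..L}. f (n + k))
     = (\<Sum>n\<in>{1..L} - {1 + k..L + k}. f n) - (\<Sum>n\<in>{1 + k..L + k} - {1..L}. f n)"
    using sum.Int_Diff[of "{1..L}" f "{1 + k..L + k}"] sum.Int_Diff[of "{1 + k..L + k}" f "{1..L}"]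
    by (simp add: Int_commute)
  moreover have bd: "\<bar>sum f A\<bar> \<le> k" if "A \<subseteq> {m + 1..m + k}" for A m
  proof -
    have "\<bar>sum f A\<bar> \<le> (\<Sum>n\<in>A. 1)" by (intro order_trans[OF sum_abs] sum_mono f)
    also have "\<dots> = real (card A)" by simp
    also have "card A \<le> card {m + 1..m + k}" by (rule card_mono[OF _ that]) simp
    finally show ?thesis using k by simp
  qed
  moreover have "\<bar>sum f ({1..L} - {1 + k..L + k})\<bar> \<le> k" using k by (intro bd[of _ 0]) auto
  moreover have "\<bar>sum f ({1 + k..L + k} - {1..L})\<bar> \<le> k" using k by (intro bd[of _ L]) auto
  ultimately show ?thesis by linarith
qed

text \<open>Translating by \<open>d\<^sub>1 z + d\<^sub>2 y + d\<^sub>3 x\<close> leaves the factor of modulus \<open>d\<^sub>i\<close> independent of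
  one of the three variables, so that \<open>box_character_sum\<close> applies for each fixed \<open>n\<close>.\<close>
lemma short_character_sum:
  assumes T: "odd_primes (T0 \<union> (T1 \<union> (T2 \<union> T3)))"
    and disj: "T0 \<inter> (T1 \<union> (T2 \<union> T3)) = {}" "T1 \<inter> (T2 \<union> T3) = {}" "T2 \<inter> T3 = {}"
    and L: "L \<ge> 0"
  shows "\<bar>\<Sum>n\<in>{1..L}. chi (T0 \<union> (T1 \<union> (T2 \<union> T3))) n\<bar>
    \<le> L * (12 ^ card T0 / real (\<Prod>T0)) powr (1/8) + 2 * real (\<Prod>T0) * (real (\<Prod>T1) + real (\<Prod>T2) + real (\<Prod>T3))"
proof -
  let ?T = "T0 \<union> (T1 \<union> (T2 \<union> T3))"
  define D where "D = int (\<Prod>T0)"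
  define d1 where "d1 = int (\<Prod>T1)"
  define d2 where "d2 = int (\<Prod>T2)"
  define d3 where "d3 = int (\<Prod>T3)"
  define R where "R = {0..<D}"
  define M where "M = (12 ^ card T0 / real (\<Prod>T0)) powr (1/8)"
  have op: "odd_primes T0" "odd_primes T1" "odd_primes T2" "odd_primes T3"
    using odd_primes_subset[OF T] by auto
  have fin: "finite T0" "finite T1" "finite T2" "finite T3" using op by (auto simp: odd_primes_def)
  have D: "D > 0" using odd_primes_prod_pos[OF op(1)] by (simp add: D_def del: of_nat_prod)
  have d0: "d1 > 0" "d2 > 0" "d3 > 0" using op odd_primes_prod_pos
    by (simp_all add: d1_def d2_def d3_def del: of_nat_prod)
  have cop: "coprime d1 D" "coprime d2 D" "coprime d3 D"
    unfolding d1_def d2_def d3_def D_def coprime_int_iff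
    using disj by (auto intro!: coprime_prod_disjoint op)
  define S where "S = (\<Sum>n\<in>{1..L}. chi ?T n)"
  have W: "\<bar>\<Sum>x\<in>R. \<Sum>y\<in>R. \<Sum>z\<in>R. chi ?T (n + (d1 * z + d2 * y + d3 * x))\<bar> \<le> real_of_int D ^ 3 * M" for n
  proof -
    have "chi ?T (n + (d1 * z + d2 * y + d3 * x))
      = chi T1 (n + (d2 * y + d3 * x)) * chi T2 (n + (d1 * z + d3 * x)) * chi T3 (n + (d1 * z + d2 * y))
        * chi T0 (n + d1 * z + d2 * y + d3 * x)" for x y z
    proof -
      have "chi ?T m = chi T1 m * chi T2 m * chi T3 m * chi T0 m" for m
        using fin disj by (simp add: chi_Un_disjoint)
      moreover have "chi T1 (n + (d1 * z + d2 * y + d3 * x)) = chi T1 (n + (d2 * y + d3 * x))"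
        by (rule chi_cong) (simp add: d1_def[symmetric] cong_iff_dvd_diff del: of_nat_prod)
      moreover have "chi T2 (n + (d1 * z + d2 * y + d3 * x)) = chi T2 (n + (d1 * z + d3 * x))"
        by (rule chi_cong) (simp add: d2_def[symmetric] cong_iff_dvd_diff del: of_nat_prod)
      moreover have "chi T3 (n + (d1 * z + d2 * y + d3 * x)) = chi T3 (n + (d1 * z + d2 * y))"
        by (rule chi_cong) (simp add: d3_def[symmetric] cong_iff_dvd_diff del: of_nat_prod)
      ultimately show ?thesis by (simp add: add.assoc)
    qed
    then show ?thesis
      using box_character_sum[OF op(1) cop(1-3)[unfolded D_def], of
          "\<lambda>x y. chi T1 (n + (d2 * y + d3 * x))" "\<lambda>x z. chi T2 (n + (d1 * z + d3 * x))"
          "\<lambda>y z. chi T3 (n + (d1 * z + d2 * y))" n]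
      by (simp add: abs_chi_le R_def D_def M_def)
  qed
  \<comment> \<open>Every translation by a point of the box is nonnegative and at most
    \<open>D * (d1 + d2 + d3)\<close>, and translating by \<open>k\<close> changes the sum by at
    most \<open>2 * k\<close>.\<close>
  define K where "K = real_of_int (2 * D * (d1 + d2 + d3))"
  have tr: "\<bar>S - (\<Sum>n\<in>{1..L}. chi ?T (n + (d1 * z + d2 * y + d3 * x)))\<bar> \<le> K"
    if "x \<in> R" "y \<in> R" "z \<in> R" for x y z
  proof -
    have "d1 * z + d2 * y + d3 * x \<le> d1 * D + d2 * D + d3 * D"
      using that d0 by (intro add_mono mult_left_mono) (auto simp: R_def)
    then have 1: "d1 * z + d2 * y + d3 * x \<le> D * (d1 + d2 + d3)" by (simp add: algebra_simps)
    have "d1 * z + d2 * y + d3 * x \<ge> 0" using that d0 by (auto simp: R_def)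
    then have "\<bar>S - (\<Sum>n\<in>{1..L}. chi ?T (n + (d1 * z + d2 * y + d3 * x)))\<bar> \<le> 2 * real_of_int (d1 * z + d2 * y + d3 * x)"
      unfolding S_def using sum_translate_bound[of "chi ?T" "d1 * z + d2 * y + d3 * x" L] abs_chi_le by auto
    also have "\<dots> \<le> 2 * real_of_int (D * (d1 + d2 + d3))"
      by (rule mult_left_mono[OF iffD2[OF of_int_le_iff 1]]) simp
    finally show ?thesis by (simp add: K_def)
  qed
  have cR: "real (card R) = D" using D by (simp add: R_def)
  have "D ^ 3 * S = (\<Sum>x\<in>R. \<Sum>y\<in>R. \<Sum>z\<in>R. S)"
    by (simp add: cR power3_eq_cube)
  also have "\<dots> = (\<Sum>x\<in>R. \<Sum>y\<in>R. \<Sum>z\<in>R. (S - (\<Sum>n\<in>{1..L}. chi ?T (n + (d1 * z + d2 * y + d3 * x)))))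
     + (\<Sum>x\<in>R. \<Sum>y\<in>R. \<Sum>z\<in>R. \<Sum>n\<in>{1..L}. chi ?T (n + (d1 * z + d2 * y + d3 * x)))"
    by (simp add: sum.distrib[symmetric])
  also have "(\<Sum>x\<in>R. \<Sum>y\<in>R. \<Sum>z\<in>R. \<Sum>n\<in>{1..L}. chi ?T (n + (d1 * z + d2 * y + d3 * x)))
     = (\<Sum>n\<in>{1..L}. \<Sum>x\<in>R. \<Sum>y\<in>R. \<Sum>z\<in>R. chi ?T (n + (d1 * z + d2 * y + d3 * x)))"
    by (simp add: sum.swap[of _ R "{1..L}"])
  finally have "\<bar>D ^ 3 * S\<bar> \<le> \<bar>\<Sum>x\<in>R. \<Sum>y\<in>R. \<Sum>z\<in>R. (S - (\<Sum>n\<in>{1..L}. chi ?T (n + (d1 * z + d2 * y + d3 * x))))\<bar>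
     + \<bar>\<Sum>n\<in>{1..L}. \<Sum>x\<in>R. \<Sum>y\<in>R. \<Sum>z\<in>R. chi ?T (n + (d1 * z + d2 * y + d3 * x))\<bar>"
    by (simp only: abs_triangle_ineq)
  also have "\<dots> \<le> (\<Sum>x\<in>R. \<Sum>y\<in>R. \<Sum>z\<in>R. K) + (\<Sum>n\<in>{1..L}. real_of_int D ^ 3 * M)"
  proof (rule add_mono)
    show "\<bar>\<Sum>x\<in>R. \<Sum>y\<in>R. \<Sum>z\<in>R. (S - (\<Sum>n\<in>{1..L}. chi ?T (n + (d1 * z + d2 * y + d3 * x))))\<bar>
        \<le> (\<Sum>x\<in>R. \<Sum>y\<in>R. \<Sum>z\<in>R. K)"
      by (intro order_trans[OF sum_abs] sum_mono tr)
    show "\<bar>\<Sum>n\<in>{1..L}. \<Sum>x\<in>R. \<Sum>y\<in>R. \<Sum>z\<in>R. chi ?T (n + (d1 * z + d2 * y + d3 * x))\<bar>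
        \<le> (\<Sum>n\<in>{1..L}. real_of_int D ^ 3 * M)"
      by (rule order_trans[OF sum_abs], rule sum_mono, rule W)
  qed
  also have "\<dots> = real_of_int D ^ 3 * (L * M + K)"
    using L by (simp add: cR power3_eq_cube algebra_simps)
  finally have "D ^ 3 * \<bar>S\<bar> \<le> real_of_int D ^ 3 * (L * M + K)" using D by (simp add: abs_mult)
  then have "\<bar>S\<bar> \<le> L * M + K" using D by simp
  then show ?thesis by (simp add: K_def S_def M_def D_def d1_def d2_def d3_def)
qed

text \<open>Any \<open>D\<close> consecutive terms add up to zero and can be cut off at the end of
  the interval, until fewer than \<open>D\<close> terms are left.\<close>

lemma incomplete_sum_bound:
  fixes f :: "int \<Rightarrow> real"
  assumes D: "D > 0" and f: "mod_periodic D f" "\<And>n. \<bar>f n\<bar> \<le> 1" and zero: "(\<Sum>x\<in>{0..<D}. f x) = 0"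
  shows "\<bar>\<Sum>n\<in>{1..L}. f n\<bar> \<le> D"
proof (induction "nat L" arbitrary: L rule: less_induct)
  case less
  show ?case
  proof (cases "L < D")
    case True
    have "\<bar>\<Sum>n\<in>{1..L}. f n\<bar> \<le> (\<Sum>n\<in>{1..L}. 1)" by (intro order_trans[OF sum_abs] sum_mono f)
    also have "\<dots> \<le> D" using True D by simp
    finally show ?thesis .
  next
    case False
    have "{1..L} = {1..L - D} \<union> {L - D + 1..L}" "{1..L - D} \<inter> {L - D + 1..L} = {}"
      using False D by auto
    then have "(\<Sum>n\<in>{1..L}. f n) = (\<Sum>n\<in>{1..L - D}. f n) + (\<Sum>n\<in>{L - D + 1..L}. f n)"
      by (simp add: sum.union_disjoint)
    also have "(\<Sum>n\<in>{L - D + 1..L}. f n) = (\<Sum>x\<in>{0..<D}. f (x + (L - D + 1)))"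
      by (rule sum.reindex_bij_witness[of _ "\<lambda>n. n + (L - D + 1)" "\<lambda>n. n - (L - D + 1)"]) auto
    also have "\<dots> = 0" using sum_periodic_shift[OF D f(1)] zero by simp
    finally show ?thesis using less[of "L - D"] False D by simp
  qed
qed

section \<open>Splitting a smooth conductor\<close>

text \<open>Greedy choice: primes are collected as long as the product stays at most
  \<open>X\<close>. A prime that would overshoot is at most \<open>z\<close>, so the product lies
  between \<open>X / z\<close> and \<open>X\<close> unless all of \<open>T\<close> has been
  used.\<close>

lemma exists_subset_prod_near:
  fixes T :: "nat set" and X z :: real
  assumes "finite T" "\<And>p. p \<in> T \<Longrightarrow> real p \<le> z" "X \<ge> 1"
  shows "\<exists>U\<subseteq>T. real (\<Prod>U) \<le> X \<and> (U = T \<or> X < real (\<Prod>U) * z)"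
  using assms(1,2)
proof (induction T rule: finite_induct)
  case empty
  then show ?case using assms(3) by simp
next
  case (insert p T)
  then obtain U where U: "U \<subseteq> T" "real (\<Prod>U) \<le> X" "U = T \<or> X < real (\<Prod>U) * z" by auto
  show ?case
  proof (cases "X < real (\<Prod>U) * z")
    case True then show ?thesis using U by blast
  next
    case False
    then have UT: "U = T" using U by simp
    show ?thesis
    proof (cases "real (\<Prod>(insert p T)) \<le> X")
      case True then show ?thesis by blast
    next
      case F: False
      have "X < real p * real (\<Prod>T)" using F insert.hyps by simp
      also have "\<dots> \<le> z * real (\<Prod>T)" using insert.prems by (intro mult_right_mono) (auto intro: prod_nonneg)
      finally have "X < real (\<Prod>T) * z" by (simp add: mult.commute)
      then show ?thesis using U UT by blast
    qed
  qed
qed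

text \<open>The target exponents are 3/96 for \<open>T0\<close> and 32/96 for \<open>T1\<close> and
  \<open>T2\<close>, each missed by at most 1/96 unless the primes run out. What remains for
  \<open>T3\<close> then has exponent at most 96/96 - 2/96 - 31/96 - 31/96 = 32/96, again 1/3. The
  translations cost 3/96 + 32/96 = 35/96.\<close>

lemma smooth_character_sum:
  fixes Q :: real
  assumes T: "odd_primes T" "T \<noteq> {}" and smooth: "\<And>p. p \<in> T \<Longrightarrow> real p \<le> Q powr (1/96)"
    and Q: "Q \<ge> 1" "real (\<Prod>T) \<le> Q" and L: "L \<ge> 0"
  shows "\<bar>\<Sum>n\<in>{1..L}. chi T n\<bar> \<le> L * (12 ^ card T / Q powr (1/48)) powr (1/8) + 6 * Q powr (35/96)"
proof -
  have fin: "finite T" using T by (simp add: odd_primes_def)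
  have Q1: "Q powr x \<ge> 1" if "x \<ge> 0" for x using Q that by (simp add: ge_one_powr_ge_zero)
  have pw: "Q powr x * Q powr y = Q powr (x + y)" for x y by (simp add: powr_add)
  obtain T0 where T0: "T0 \<subseteq> T" "real (\<Prod>T0) \<le> Q powr (1/32)"
      "T0 = T \<or> Q powr (1/32) < real (\<Prod>T0) * Q powr (1/96)"
    using exists_subset_prod_near[OF fin smooth Q1[of "1/32"]] by auto
  show ?thesis
  proof (cases "T0 = T")
    \<comment> \<open>A conductor too small to fill \<open>T0\<close> needs no translations: whole
      periods cancel, and \<open>Q powr (1/32)\<close> is below the error that the translations
      would cost.\<close>
    case True
    have "\<bar>\<Sum>n\<in>{1..L}. chi T n\<bar> \<le> real_of_int (int (\<Prod>T))"
      using odd_primes_prod_pos[OF T(1)]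
      by (intro incomplete_sum_bound chi_periodic abs_chi_le sum_chi_complete[OF T]) (simp del: of_nat_prod)
    also have "\<dots> = real (\<Prod>T)" by simp
    also have "\<dots> \<le> Q powr (1/32)" using T0 True by simp
    also have "\<dots> \<le> 6 * Q powr (35/96)"
      using powr_mono[of "1/32" "35/96" Q] Q Q1[of "35/96"] by simp
    finally show ?thesis using L by (simp add: add_increasing)
  next
    case False
    have "Q powr (1/48) * Q powr (1/96) < real (\<Prod>T0) * Q powr (1/96)" using T0 False by (simp add: pw)
    then have D: "Q powr (1/48) < real (\<Prod>T0)" using Q by simp
    obtain T1 where T1: "T1 \<subseteq> T - T0" "real (\<Prod>T1) \<le> Q powr (1/3)"
        "T1 = T - T0 \<or> Q powr (1/3) < real (\<Prod>T1) * Q powr (1/96)"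
      using exists_subset_prod_near[of "T - T0" "Q powr (1/96)" "Q powr (1/3)"] fin smooth Q1[of "1/3"] by auto
    obtain T2 where T2: "T2 \<subseteq> T - T0 - T1" "real (\<Prod>T2) \<le> Q powr (1/3)"
        "T2 = T - T0 - T1 \<or> Q powr (1/3) < real (\<Prod>T2) * Q powr (1/96)"
      using exists_subset_prod_near[of "T - T0 - T1" "Q powr (1/96)" "Q powr (1/3)"] fin smooth Q1[of "1/3"] by auto
    define T3 where "T3 = T - T0 - T1 - T2"
    have Teq: "T = T0 \<union> (T1 \<union> (T2 \<union> T3))" using T0 T1 T2 by (auto simp: T3_def)
    have disj: "T0 \<inter> (T1 \<union> (T2 \<union> T3)) = {}" "T1 \<inter> (T2 \<union> T3) = {}" "T2 \<inter> T3 = {}"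
      using T1 T2 by (auto simp: T3_def)
    have fins: "finite T0" "finite T1" "finite T2" "finite T3" using fin Teq by (metis finite_Un)+
    have T3: "real (\<Prod>T3) \<le> Q powr (1/3)"
    proof (cases "T3 = {}")
      case True then show ?thesis using Q1[of "1/3"] by simp
    next
      \<comment> \<open>A nonempty \<open>T3\<close> shows that neither \<open>T1\<close> nor
        \<open>T2\<close> has exhausted the primes available to it, so that both lower bounds
        hold.\<close>
      case ne: False
      have "Q powr (31/96) * Q powr (1/96) < real (\<Prod>T1) * Q powr (1/96)"
        "Q powr (31/96) * Q powr (1/96) < real (\<Prod>T2) * Q powr (1/96)"
        using T1 T2 ne by (auto simp: pw T3_def)
      then have d12: "Q powr (31/96) < real (\<Prod>T1)" "Q powr (31/96) < real (\<Prod>T2)" using Q by simp_all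
      have "Q powr (2/3) * real (\<Prod>T3) = Q powr (1/48) * (Q powr (31/96) * (Q powr (31/96) * real (\<Prod>T3)))"
        by (simp add: pw mult.assoc[symmetric])
      also have "\<dots> \<le> real (\<Prod>T0) * (real (\<Prod>T1) * (real (\<Prod>T2) * real (\<Prod>T3)))"
        using D d12 by (intro mult_mono) (auto intro!: mult_nonneg_nonneg prod_nonneg)
      also have "\<dots> = real (\<Prod>T)"
        unfolding Teq using fins disj by (simp add: prod.union_disjoint)
      also have "\<dots> \<le> Q powr (2/3) * Q powr (1/3)" using Q by (simp add: pw)
      finally show ?thesis using Q by simp
    qed
    have op0: "real (\<Prod>T0) > 0" using D Q Q1[of "1/48"] by linarith
    have "\<bar>\<Sum>n\<in>{1..L}. chi T n\<bar> \<le> L * (12 ^ card T0 / real (\<Prod>T0)) powr (1/8)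
        + 2 * real (\<Prod>T0) * (real (\<Prod>T1) + real (\<Prod>T2) + real (\<Prod>T3))"
      using short_character_sum[of T0 T1 T2 T3 L] disj T(1) L unfolding Teq by simp
    also have "\<dots> \<le> L * (12 ^ card T / Q powr (1/48)) powr (1/8)
        + 2 * Q powr (1/32) * (Q powr (1/3) + Q powr (1/3) + Q powr (1/3))"
      using T0 T1 T2 T3 D op0 L Q card_mono[OF fin T0(1)]
      by (intro add_mono mult_mono powr_mono2 frac_le power_increasing) (auto simp del: of_nat_prod)
    also have "2 * Q powr (1/32) * (Q powr (1/3) + Q powr (1/3) + Q powr (1/3)) = 6 * Q powr (35/96)"
      by (simp add: pw)
    finally show ?thesis .
  qed
qed

section \<open>Divisor bounds\<close>

text \<open>The classical argument for the divisor function. A prime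
  \<open>p \<ge> (2 * c) powr (1 / \<kappa>)\<close> costs nothing, because
  \<open>c * (k + 1) \<le> (2 * c) ^ k \<le> p powr (\<kappa> * k)\<close> for \<open>k > 0\<close>;
  the finitely many smaller primes cost at most a factor \<open>K\<close> each. The parameter
  \<open>c\<close> makes room for powers \<open>a ^ card (prime_factors n)\<close> as well.\<close>

lemma growth_from_prime_powers:
  fixes f :: "nat \<Rightarrow> real"
  assumes f1: "f 1 \<le> 1" and c: "c \<ge> 1" and nn: "\<And>n. f n \<ge> 0"
    and step: "\<And>p k m. prime p \<Longrightarrow> k > 0 \<Longrightarrow> m > 0 \<Longrightarrow> \<not> p dvd m \<Longrightarrow> f (p ^ k * m) \<le> c * (real k + 1) * f m"
    and \<kappa>: "\<kappa> > 0"
  shows "\<exists>C>0. \<forall>n>0. f n \<le> C * real n powr \<kappa>"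
proof -
  define K where "K = c * (1 + 1 / (\<kappa> * ln 2))"
  have K1: "K \<ge> 1" using c \<kappa> mult_mono[of 1 c 1 "1 + 1 / (\<kappa> * ln 2)"] by (simp add: K_def)
  have K: "c * (real k + 1) \<le> K * real p powr (\<kappa> * k)" if "p \<ge> 2" for k p :: nat
  proof -
    \<comment> \<open>With \<open>A = \<kappa> * ln 2\<close>, the product
      \<open>(1 + 1 / A) * (1 + A * k)\<close> contains the terms \<open>1\<close> and
      \<open>k\<close>; the second factor is at most
      \<open>exp (A * k) = 2 powr (\<kappa> * k)\<close>.\<close>
    have "real k + 1 \<le> (1 + 1 / (\<kappa> * ln 2)) * (1 + \<kappa> * k * ln 2)"
      using \<kappa> by (simp add: field_simps)
    also have "\<dots> \<le> (1 + 1 / (\<kappa> * ln 2)) * 2 powr (\<kappa> * k)"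
      using \<kappa> exp_ge_add_one_self[of "\<kappa> * k * ln 2"]
      by (intro mult_left_mono) (simp_all add: powr_def mult_ac)
    also have "\<dots> \<le> (1 + 1 / (\<kappa> * ln 2)) * real p powr (\<kappa> * k)"
      using \<kappa> that by (intro mult_left_mono powr_mono2) auto
    finally show ?thesis using c by (simp add: K_def mult.assoc mult_left_mono)
  qed
  define y where "y = (2 * c) powr (1 / \<kappa>)"
  have y0: "y > 0" using c by (simp add: y_def)
  have big: "c * (real k + 1) \<le> real p powr (\<kappa> * k)" if "real p \<ge> y" "k > 0" for k p :: nat
  proof -
    have "real k + 1 \<le> 2 ^ k" using of_nat_mono[OF Suc_leI[OF less_exp[of k]], where ?'a = real] by simp
    moreover have "c \<le> c ^ k" using c that(2) power_increasing[of 1 k c] by simp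
    ultimately have "c * (real k + 1) \<le> c ^ k * 2 ^ k" using c by (intro mult_mono) auto
    also have "\<dots> = (y powr \<kappa>) ^ k" using c \<kappa> by (simp add: y_def powr_powr power_mult_distrib)
    also have "\<dots> \<le> (real p powr \<kappa>) ^ k" using that(1) \<kappa> by (intro power_mono powr_mono2) (auto simp: y_def)
    also have "\<dots> = real p powr (\<kappa> * k)" using y0 that(1) by (simp add: powr_power mult.commute)
    finally show ?thesis .
  qed
  define B where "B = {p::nat. real p < y}"
  have finB: "finite B" by (rule finite_subset[of _ "{..nat \<lceil>y\<rceil>}"]) (auto simp: B_def, linarith)
  \<comment> \<open>Counting only the small primes that divide \<open>n\<close> lets the induction
    close; the count is at most \<open>card B\<close>, uniformly in \<open>n\<close>.\<close>
  have main: "f n \<le> K ^ card (B \<inter> prime_factors n) * real n powr \<kappa>" if "n > 0" for n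
    using that
  proof (induction n rule: less_induct)
    case (less n)
    show ?case
    proof (cases "n = 1")
      case True then show ?thesis using f1 by simp
    next
      case False
      then obtain p where p: "prime p" "p dvd n" using prime_factor_nat by blast
      define k where "k = multiplicity p n"
      obtain m where m: "n = p ^ k * m" "\<not> p dvd m"
        using multiplicity_decompose'[of n p] less.prems prime_gt_1_nat[OF p(1)] by (auto simp: k_def)
      have k: "k > 0" using p less.prems by (simp add: k_def prime_multiplicity_gt_zero_iff)
      have m0: "m > 0" using m less.prems by (auto intro: Nat.gr0I)
      have p2: "p \<ge> 2" using p(1) by (rule prime_ge_2_nat)
      have "1 < p ^ k" using one_less_power[of p k] k p2 by simp
      then have mn: "m < n" using m m0 by simp
      have pf: "prime_factors n = insert p (prime_factors m)"
        using m m0 p(1) k by (simp add: prime_factors_product prime_factorization_prime_power)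
      have pm: "p \<notin> prime_factors m" using m by (auto dest: in_prime_factors_imp_dvd)
      have IH: "f m \<le> K ^ card (B \<inter> prime_factors m) * real m powr \<kappa>" by (rule less.IH[OF mn m0])
      have np: "real n powr \<kappa> = real p powr (\<kappa> * k) * real m powr \<kappa>"
        using p2 m0 by (simp add: m(1) powr_mult powr_powr mult.commute flip: powr_realpow)
      have "f n \<le> c * (real k + 1) * f m" unfolding m(1) by (rule step) (use p k m m0 in auto)
      also have "\<dots> \<le> K ^ card (B \<inter> prime_factors n) * real n powr \<kappa>"
      proof (cases "p \<in> B")
        case True
        have "c * (real k + 1) * f m \<le> (K * real p powr (\<kappa> * k)) * (K ^ card (B \<inter> prime_factors m) * real m powr \<kappa>)"
          by (rule mult_mono) (use K[OF p2] IH nn K1 in auto)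
        also have "\<dots> = K ^ card (B \<inter> prime_factors n) * real n powr \<kappa>"
          using True pm finB by (simp add: pf np mult_ac)
        finally show ?thesis .
      next
        case False
        have "c * (real k + 1) * f m \<le> real p powr (\<kappa> * k) * (K ^ card (B \<inter> prime_factors m) * real m powr \<kappa>)"
          by (rule mult_mono) (use big[of p k] False k IH nn in \<open>auto simp: B_def\<close>)
        also have "\<dots> = K ^ card (B \<inter> prime_factors n) * real n powr \<kappa>"
          using False by (simp add: pf np mult_ac)
        finally show ?thesis .
      qed
      finally show ?thesis .
    qed
  qed
  show ?thesis
  proof (intro exI[of _ "K ^ card B"] conjI allI impI)
    show "K ^ card B > 0" using K1 by simp
    fix n :: nat assume "n > 0"
    have "K ^ card (B \<inter> prime_factors n) \<le> K ^ card B"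
      using K1 finB by (intro power_increasing card_mono) auto
    then have "K ^ card (B \<inter> prime_factors n) * real n powr \<kappa> \<le> K ^ card B * real n powr \<kappa>"
      by (rule mult_right_mono) simp
    with main[OF \<open>n > 0\<close>] show "f n \<le> K ^ card B * real n powr \<kappa>" by simp
  qed
qed

lemma divisor_bound:
  fixes \<kappa> :: real
  assumes "\<kappa> > 0"
  shows "\<exists>C>0. \<forall>n>0. real (card {d. d dvd n}) \<le> C * real n powr \<kappa>"
proof (rule growth_from_prime_powers[of _ 1, OF _ _ _ _ assms])
  fix p k m :: nat
  assume *: "prime p" "m > 0"
  have "{d. d dvd p ^ k * m} \<subseteq> (\<lambda>(i, e). p ^ i * e) ` ({..k} \<times> {d. d dvd m})"
  proof
    fix d assume "d \<in> {d. d dvd p ^ k * m}"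
    then obtain b e where "d = b * e" "b dvd p ^ k" "e dvd m" using division_decomp[of d "p ^ k" m] by auto
    moreover from this obtain i where "i \<le> k" "b = p ^ i" using *(1) divides_primepow_nat by blast
    ultimately show "d \<in> (\<lambda>(i, e). p ^ i * e) ` ({..k} \<times> {d. d dvd m})" by auto
  qed
  then have "card {d. d dvd p ^ k * m} \<le> card ({..k} \<times> {d. d dvd m})"
    using * by (intro surj_card_le) auto
  also have "\<dots> = (k + 1) * card {d. d dvd m}" by (simp add: card_cartesian_product)
  finally have "real (card {d. d dvd p ^ k * m}) \<le> real ((k + 1) * card {d. d dvd m})"
    by (simp only: of_nat_le_iff)
  then show "real (card {d. d dvd p ^ k * m}) \<le> 1 * (real k + 1) * real (card {d. d dvd m})"
    by (simp add: algebra_simps)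
qed auto

text \<open>This absorbs the losses that are exponential in the number of primes: base 4 for the
  expansion into characters together with the sieve, base 12 for
  \<open>sum_quad_corr_sq\<close>.\<close>

lemma prime_omega_bound:
  fixes \<kappa> a :: real
  assumes "\<kappa> > 0" "a \<ge> 1"
  shows "\<exists>C>0. \<forall>n>0. a ^ card (prime_factors n) \<le> C * real n powr \<kappa>"
proof (rule growth_from_prime_powers[of _ a, OF _ assms(2) _ _ assms(1)])
  fix p k m :: nat
  assume *: "prime p" "k > 0" "m > 0"
  have "prime_factors (p ^ k * m) = insert p (prime_factors m)"
    using * by (simp add: prime_factors_product prime_factorization_prime_power)
  then have "card (prime_factors (p ^ k * m)) \<le> Suc (card (prime_factors m))" by (simp add: card_insert_le_m1 card_insert_if)
  then have "a ^ card (prime_factors (p ^ k * m)) \<le> a * a ^ card (prime_factors m)"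
    using power_increasing[OF _ assms(2)] by fastforce
  also have "\<dots> \<le> a * (real k + 1) * a ^ card (prime_factors m)"
    using assms(2) by (intro mult_right_mono) auto
  finally show "a ^ card (prime_factors (p ^ k * m)) \<le> a * (real k + 1) * a ^ card (prime_factors m)" .
qed (use assms in auto)

section \<open>Counting square roots\<close>

definition odd_prime_divisors :: "nat \<Rightarrow> nat set" where
  "odd_prime_divisors q = {p. prime p \<and> odd p \<and> p dvd q}"

lemma odd_primes_odd_prime_divisors: "q > 0 \<Longrightarrow> odd_primes (odd_prime_divisors q)"
  unfolding odd_primes_def odd_prime_divisors_def
  by (auto intro: finite_subset[of _ "{d. d dvd q}"])

lemma int_dvd_from_prime_powers:
  assumes q: "q > 0" and "\<And>p. prime p \<Longrightarrow> p dvd q \<Longrightarrow> int p ^ multiplicity p q dvd x"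
  shows "int q dvd x"
proof (cases "x = 0")
  case False
  have "q dvd nat \<bar>x\<bar>"
  proof (rule multiplicity_le_imp_dvd)
    fix p :: nat assume p: "prime p"
    show "multiplicity p q \<le> multiplicity p (nat \<bar>x\<bar>)"
    proof (cases "p dvd q")
      case True
      have "int (p ^ multiplicity p q) dvd x" using assms(2)[OF p True] by simp
      then have "p ^ multiplicity p q dvd nat \<bar>x\<bar>" by (simp only: dvd_nat_abs_iff)
      then show ?thesis using p False by (intro multiplicity_geI) (auto dest: prime_gt_1_nat)
    next
      case F: False
      then show ?thesis by (simp add: not_dvd_imp_multiplicity_0)
    qed
  qed (use q in auto)
  then show ?thesis by (simp only: dvd_nat_abs_iff)
qed simp

text \<open>Both \<open>b - b0\<close> and \<open>b + b0\<close> are even, but 4 cannot divide both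
  because their sum is \<open>2 * b\<close> with \<open>b\<close> odd. Hence
  \<open>2 ^ (k - 1)\<close> divides one of them, and each of the classes of \<open>b0\<close> and
  \<open>- b0\<close> modulo \<open>2 ^ (k - 1)\<close> has two lifts modulo
  \<open>2 ^ k\<close>.\<close>

lemma card_residues_mod_2_power:
  fixes B :: "int set"
  assumes "k \<ge> 2" and b0: "odd b0" and B: "\<And>b. b \<in> B \<Longrightarrow> odd b \<and> 2 ^ k dvd (b - b0) * (b + b0)"
  shows "card ((\<lambda>b. b mod 2 ^ k) ` B) \<le> 4"
proof -
  obtain j where k: "k = Suc (Suc j)" using assms(1) by (metis add_2_eq_Suc le_Suc_ex)
  define M :: int where "M = 2 ^ Suc j"
  have kM: "2 ^ k = 2 * M" by (simp add: M_def k)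
  have half: "b mod (2 * M) \<in> {c mod (2 * M), (c + M) mod (2 * M)}" if bc: "M dvd b - c" for b c
  proof -
    obtain i where "b - c = M * i" using bc by (elim dvdE)
    then have i: "b = c + M * i" by simp
    show ?thesis
    proof (cases "even i")
      case True
      then obtain u where "i = 2 * u" by blast
      then have "b = c + u * (2 * M)" using i by simp
      then show ?thesis by simp
    next
      case False
      then obtain u where "i = 2 * u + 1" by (elim oddE)
      then have "b = (c + M) + u * (2 * M)" using i by (simp add: algebra_simps)
      then show ?thesis by simp
    qed
  qed
  have cancel: "M dvd x" if xy: "2 * M dvd x * y" "even y" "\<not> 4 dvd y" for x y
  proof -
    obtain w where w: "y = 2 * w" using xy(2) by blast
    have "odd w" using xy(3) w by auto
    then have "coprime M w" by (simp add: M_def)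
    moreover have "M dvd x * w" using xy(1) w by simp
    ultimately show ?thesis by (simp add: coprime_dvd_mult_left_iff)
  qed
  have "(\<lambda>b. b mod 2 ^ k) ` B \<subseteq> {b0 mod (2 * M), (b0 + M) mod (2 * M), (- b0) mod (2 * M), (- b0 + M) mod (2 * M)}"
  proof
    fix z assume "z \<in> (\<lambda>b. b mod 2 ^ k) ` B"
    then obtain b where b: "b \<in> B" "z = b mod (2 * M)" by (auto simp: kM)
    have bb: "odd b" "2 * M dvd (b - b0) * (b + b0)" using B[OF b(1)] kM by auto
    have "\<not> 4 dvd b + b0 \<or> \<not> 4 dvd b - b0"
    proof (rule ccontr)
      assume "\<not> ?thesis"
      then have "4 dvd b + b0" "4 dvd b - b0" by auto
      then have "4 dvd (b + b0) + (b - b0)" by (rule dvd_add)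
      then have "4 dvd 2 * b" by simp
      then have "2 dvd b" by presburger
      then show False using bb(1) by simp
    qed
    then have "M dvd b - b0 \<or> M dvd b - (- b0)"
    proof
      assume "\<not> 4 dvd b + b0"
      then show ?thesis using cancel[OF bb(2)] bb(1) b0 by simp
    next
      assume "\<not> 4 dvd b - b0"
      moreover have "2 * M dvd (b + b0) * (b - b0)" using bb(2) by (simp add: mult.commute)
      ultimately have "M dvd b + b0" using cancel[of "b + b0" "b - b0"] bb(1) b0 by simp
      then show ?thesis by simp
    qed
    then show "z \<in> {b0 mod (2 * M), (b0 + M) mod (2 * M), (- b0) mod (2 * M), (- b0 + M) mod (2 * M)}"
      using half[of b b0] half[of b "- b0"] b(2) by auto
  qed
  then have "card ((\<lambda>b. b mod 2 ^ k) ` B) \<le> card {b0 mod (2 * M), (b0 + M) mod (2 * M), (- b0) mod (2 * M), (- b0 + M) mod (2 * M)}"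
    by (intro card_mono) auto
  also have "\<dots> \<le> 4" by (simp add: card_insert_if)
  finally show ?thesis .
qed

text \<open>A solution \<open>b\<close> is determined by its block of length \<open>q\<close>, its residue modulo the power of 2
  in \<open>q\<close>, and the set of odd \<open>p\<close> for which \<open>b\<close> agrees with a fixed solution \<open>b\<^sub>0\<close> (otherwise it
  agrees with \<open>- b\<^sub>0\<close>).\<close>
lemma card_square_roots_le:
  fixes n :: int and q s E :: nat
  assumes q: "q > 0" and s: "\<And>p. prime p \<Longrightarrow> p\<^sup>2 dvd q \<Longrightarrow> p dvd s"
  shows "real (card {b \<in> {1..E * q}. coprime b s \<and> [int b ^ 2 = n] (mod int q)})
    \<le> 4 * real E * (\<Prod>p\<in>odd_prime_divisors q. 1 + chi {p} n)"
proof -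
  define B where "B = {b \<in> {1..E * q}. coprime b s \<and> [int b ^ 2 = n] (mod int q)}"
  define P where "P = odd_prime_divisors q"
  have finP: "finite P" using odd_primes_odd_prime_divisors[OF q] by (simp add: odd_primes_def P_def)
  have finB: "finite B" by (simp add: B_def)
  have "real (card B) \<le> 4 * real E * (\<Prod>p\<in>P. 1 + chi {p} n)"
  proof (cases "B = {}")
    case True
    have "(\<Prod>p\<in>P. 1 + chi {p} n) \<ge> 0"
    proof (rule prod_nonneg)
      fix p show "1 + chi {p} n \<ge> 0" using abs_chi_le[of "{p}" n] by linarith
    qed
    then show ?thesis by (simp add: True)
  next
    case False
    then obtain b0 where b0: "b0 \<in> B" by blast
    define U where "U = {p \<in> P. \<not> int p dvd n}"
    define k where "k = multiplicity 2 q"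
    define \<phi> where "\<phi> b = ((b - 1) div q, {p \<in> U. int p dvd int b - int b0}, int b mod 2 ^ k)" for b
    have finU: "finite U" using finP by (simp add: U_def)
    have sq: "[int b ^ 2 = n] (mod int p)" if "b \<in> B" "p dvd q" for b p
      using that cong_dvd_modulus[of "int b ^ 2" n "int q" "int p"] by (simp add: B_def)
    have ndvd: "\<not> int p dvd int b" if "b \<in> B" "p \<in> U" for b p
    proof
      assume "int p dvd int b"
      then have "int p dvd int b ^ 2" by (simp add: power2_eq_square)
      moreover have "p dvd q" using that by (simp add: U_def P_def odd_prime_divisors_def)
      ultimately have "int p dvd n" using cong_dvd_iff[OF sq[OF that(1)]] by blast
      then show False using that by (simp add: U_def)
    qed
    \<comment> \<open>As a solution exists, \<open>chi {p} n\<close> is 1 for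
      \<open>p \<in> U\<close> and 0 for the other primes. The weight is therefore exactly the
      number of possible sign patterns.\<close>
    have prodU: "(\<Prod>p\<in>P. 1 + chi {p} n) = 2 ^ card U"
    proof -
      have "1 + chi {p} n = (if p \<in> U then 2 else 1)" if "p \<in> P" for p
      proof (cases "p \<in> U")
        case True
        have "QuadRes (int p) n"
          using sq[OF b0, of p] that by (auto simp: QuadRes_def P_def odd_prime_divisors_def)
        then show ?thesis using True by (simp add: chi_def Legendre_def U_def cong_0_iff)
      next
        case False
        then show ?thesis using that by (simp add: chi_def Legendre_def U_def cong_0_iff)
      qed
      then have "(\<Prod>p\<in>P. 1 + chi {p} n) = (\<Prod>p\<in>P. if p \<in> U then 2 else 1)" by simp
      also have "\<dots> = (\<Prod>p\<in>U. 2)"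
        using finP by (intro prod.mono_neutral_cong_right) (auto simp: U_def)
      finally show ?thesis by simp
    qed
    have diff: "int q dvd (int b - int b0) * (int b + int b0)" if "b \<in> B" for b
    proof -
      have "[int b ^ 2 = int b0 ^ 2] (mod int q)"
        using that b0 by (simp add: B_def cong_def)
      then have "int q dvd int b ^ 2 - int b0 ^ 2" by (simp add: cong_iff_dvd_diff)
      then show ?thesis by (simp add: power2_eq_square algebra_simps)
    qed
    \<comment> \<open>An odd prime that does not divide \<open>b\<close> cannot divide both
      \<open>b - b0\<close> and \<open>b + b0\<close>, so its full power in \<open>q\<close> falls
      into one of the two.\<close>
    have odd_case: "int p ^ multiplicity p q dvd int b - int b0 \<and> int p dvd int b - int b0
        \<or> int p ^ multiplicity p q dvd int b + int b0 \<and> \<not> int p dvd int b - int b0"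
      if b: "b \<in> B" and p: "p \<in> U" for b p
    proof -
      have pp: "prime p" "odd p" "p dvd q" using p by (auto simp: U_def P_def odd_prime_divisors_def)
      have ip: "prime (int p)" using pp by simp
      have "int (p ^ multiplicity p q) dvd int q" by (simp only: int_dvd_int_iff multiplicity_dvd)
      then have d: "int p ^ multiplicity p q dvd (int b - int b0) * (int b + int b0)"
        using diff[OF b] by (simp add: dvd_trans)
      show ?thesis
      proof (cases "int p dvd int b - int b0")
        case True
        have "\<not> int p dvd int b + int b0"
        proof
          assume "int p dvd int b + int b0"
          then have "int p dvd (int b + int b0) + (int b - int b0)" using True by (rule dvd_add)
          then have "int p dvd 2 * int b" by simp
          then have "int p dvd 2" using ndvd[OF b p] prime_dvd_mult_iff[OF ip] by blast
          then have "p dvd 2" using int_dvd_int_iff[of p 2] by simp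
          then show False using pp primes_dvd_imp_eq[OF pp(1) two_is_prime_nat] by simp
        qed
        then have "coprime (int p ^ multiplicity p q) (int b + int b0)"
          using ip by (simp add: prime_imp_coprime)
        then show ?thesis using d True by (simp add: coprime_dvd_mult_left_iff)
      next
        case False
        then have "coprime (int p ^ multiplicity p q) (int b - int b0)"
          using ip by (simp add: prime_imp_coprime)
        then show ?thesis using d False by (simp add: coprime_dvd_mult_right_iff)
      qed
    qed
    have inj: "inj_on \<phi> B"
    proof (rule inj_onI)
      fix b b' assume b: "b \<in> B" "b' \<in> B" and eq: "\<phi> b = \<phi> b'"
      have "int q dvd int b - int b'"
      proof (rule int_dvd_from_prime_powers[OF q])
        fix p :: nat assume p: "prime p" "p dvd q"
        have ip: "prime (int p)" using p by simp
        consider "p = 2" | "p \<in> U" | "p \<in> P" "int p dvd n"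
          using p primes_dvd_imp_eq[OF two_is_prime_nat p(1)] by (auto simp: U_def P_def odd_prime_divisors_def)
        then show "int p ^ multiplicity p q dvd int b - int b'"
        proof cases
          case 1
          then show ?thesis using eq by (simp add: \<phi>_def k_def mod_eq_dvd_iff)
        next
          case 2
          have "int p dvd int b - int b0 \<longleftrightarrow> int p dvd int b' - int b0"
            using eq 2 by (auto simp: \<phi>_def)
          then consider "int p ^ multiplicity p q dvd int b - int b0" "int p ^ multiplicity p q dvd int b' - int b0"
            | "int p ^ multiplicity p q dvd int b + int b0" "int p ^ multiplicity p q dvd int b' + int b0"
            using odd_case[OF b(1) 2] odd_case[OF b(2) 2] by blast
          then show ?thesis
          proof cases
            case 1 then show ?thesis using dvd_diff[OF 1] by simp
          next
            case 2 then show ?thesis using dvd_diff[OF 2] by simp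
          qed
        next
          \<comment> \<open>A prime dividing both \<open>q\<close> and \<open>n\<close> divides
            every solution. Coprimality to \<open>s\<close> then excludes
            \<open>p\<^sup>2 dvd q\<close>, so \<open>p\<close> occurs only once in \<open>q\<close>
            and divisibility by \<open>p\<close> suffices.\<close>
          case 3
          have pd: "int p dvd int x" if x: "x \<in> B" for x
          proof -
            have "int p dvd int x ^ 2" using 3(2) cong_dvd_iff[OF sq[OF x p(2)]] by blast
            then show ?thesis by (rule prime_dvd_power[OF ip])
          qed
          have "\<not> p\<^sup>2 dvd q"
          proof
            assume "p\<^sup>2 dvd q"
            then have "p dvd s" using s p by blast
            moreover have "p dvd b" using pd[OF b(1)] by simp
            moreover have "coprime b s" using b by (simp add: B_def)
            ultimately show False using p(1) coprime_common_divisor[of b s p] by simp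
          qed
          then have "multiplicity p q \<le> 1" using multiplicity_dvd'[of 2 p q] by linarith
          then have "int p ^ multiplicity p q dvd int p"
            using le_imp_power_dvd[of "multiplicity p q" 1 "int p"] by simp
          then show ?thesis by (rule dvd_trans[OF _ dvd_diff[OF pd[OF b(1)] pd[OF b(2)]]])
        qed
      qed
      then have "int (b - 1) mod int q = int (b' - 1) mod int q"
        using b by (simp add: mod_eq_dvd_iff B_def of_nat_diff)
      then have m: "(b - 1) mod q = (b' - 1) mod q" by (simp flip: of_nat_mod)
      have d: "(b - 1) div q = (b' - 1) div q" using eq by (simp add: \<phi>_def)
      have "b - 1 = (b - 1) div q * q + (b - 1) mod q" by simp
      also have "\<dots> = (b' - 1) div q * q + (b' - 1) mod q" by (simp only: d m)
      also have "\<dots> = b' - 1" by simp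
      finally have "b - 1 = b' - 1" .
      then show "b = b'" using b by (auto simp: B_def)
    qed
    have card2: "card ((\<lambda>b. int b mod 2 ^ k) ` B) \<le> 4"
    \<comment> \<open>If \<open>4 dvd q\<close>, the assumption on \<open>s\<close> forces all
      solutions to be odd, as \<open>card_residues_mod_2_power\<close> requires; otherwise there are
      at most two residues anyway.\<close>
    proof (cases "k \<ge> 2")
      case True
      have "2 ^ 2 dvd q" using multiplicity_dvd'[of 2 2 q] True by (simp add: k_def)
      then have "2 dvd s" using s[of 2] by simp
      then have oddB: "odd b" if "b \<in> B" for b
        using that coprime_common_divisor[of b s 2] by (auto simp: B_def)
      have "int (2 ^ k) dvd int q" unfolding k_def by (simp only: int_dvd_int_iff multiplicity_dvd)
      then have "2 ^ k dvd (int b - int b0) * (int b + int b0)" if "b \<in> B" for b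
        using diff[OF that] by (simp add: dvd_trans)
      then have "card ((\<lambda>b. b mod 2 ^ k) ` (int ` B)) \<le> 4"
        using oddB b0 by (intro card_residues_mod_2_power[OF True, of "int b0"]) auto
      then show ?thesis by (simp add: image_image)
    next
      case False
      then have "k = 0 \<or> k = 1" by linarith
      then have "(\<lambda>b. int b mod 2 ^ k) ` B \<subseteq> {0, 1}" by auto
      then have "card ((\<lambda>b. int b mod 2 ^ k) ` B) \<le> card {0, 1 :: int}" by (intro card_mono) auto
      then show ?thesis by simp
    qed
    have "\<phi> ` B \<subseteq> {..<E} \<times> Pow U \<times> (\<lambda>b. int b mod 2 ^ k) ` B"
    proof
      fix z assume "z \<in> \<phi> ` B"
      then obtain b where b: "b \<in> B" "z = \<phi> b" by blast
      have "b - 1 < E * q" using b by (auto simp: B_def)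
      then have "(b - 1) div q < E" using q by (simp add: div_less_iff_less_mult)
      then show "z \<in> {..<E} \<times> Pow U \<times> (\<lambda>b. int b mod 2 ^ k) ` B" using b by (auto simp: \<phi>_def)
    qed
    then have "card B \<le> card ({..<E} \<times> Pow U \<times> (\<lambda>b. int b mod 2 ^ k) ` B)"
      using finU finB by (intro card_inj_on_le[OF inj]) auto
    also have "\<dots> = E * (2 ^ card U * card ((\<lambda>b. int b mod 2 ^ k) ` B))"
      using finU by (simp add: card_cartesian_product card_Pow)
    also have "\<dots> \<le> E * (2 ^ card U * 4)" using card2 by simp
    finally have "real (card B) \<le> real (E * (2 ^ card U * 4))" by (simp only: of_nat_le_iff)
    then show ?thesis by (simp add: prodU)
  qed
  then show ?thesis by (simp only: B_def P_def)
qed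

section \<open>Sieving an interval by a finite set of primes\<close>

text \<open>Positive half of the symmetric range \<open>\<bar>n\<bar> < X\<close>; the strict upper
  bound comes from the strict inequality in \<open>A_count\<close>.\<close>

definition below :: "real \<Rightarrow> int set" where
  "below X = {n. 0 < n \<and> real_of_int n < X}"

lemma below_eq: "below X = {1..\<lceil>X\<rceil> - 1}"
  by (auto simp: below_def less_ceiling_iff) 

lemma finite_below [simp]: "finite (below X)" by (simp add: below_eq)

lemma card_below_approx:
  assumes "X > 0"
  shows "\<bar>real (card (below X)) - X\<bar> \<le> 1"
proof -
  have "\<lceil>X\<rceil> \<ge> 1" using assms by simp
  then have "real (card (below X)) = of_int \<lceil>X\<rceil> - 1" by (simp add: below_eq)
  then show ?thesis by linarith
qed

lemma card_below_le:
  assumes "X > 0"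
  shows "real (card (below X)) \<le> X"
proof -
  have "\<lceil>X\<rceil> \<ge> 1" using assms by simp
  then have "real (card (below X)) = of_int \<lceil>X\<rceil> - 1" by (simp add: below_eq)
  then show ?thesis by linarith
qed

text \<open>Inclusion-exclusion, one prime at a time. The multiples of \<open>p\<close> are
  \<open>p\<close> times the same sifted set for \<open>X / p\<close>, which explains the assumption
  for all \<open>Y \<le> X\<close>, and multiplicativity takes out \<open>f p\<close>. Each prime
  doubles the error. The condition \<open>f p * c = c\<close> covers both applications: the constant
  function with \<open>c = 1\<close>, and a character, which has no main term, with
  \<open>c = 0\<close>.\<close>

lemma sieved_sum:
  fixes f :: "int \<Rightarrow> real"
  assumes P: "finite P" "\<And>p. p \<in> P \<Longrightarrow> prime (p::nat)"
    and f: "\<And>a b. f (a * b) = f a * f b" "\<And>n. \<bar>f n\<bar> \<le> 1"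
    and c: "\<And>p. p \<in> P \<Longrightarrow> f (int p) * c = c"
    and B: "\<And>Y. 0 < Y \<Longrightarrow> Y \<le> X \<Longrightarrow> \<bar>(\<Sum>n\<in>below Y. f n) - c * Y\<bar> \<le> B"
    and X: "X > 0"
  shows "\<bar>(\<Sum>n\<in>{n \<in> below X. \<forall>p\<in>P. \<not> int p dvd n}. f n) - c * X * (\<Prod>p\<in>P. 1 - 1 / real p)\<bar> \<le> 2 ^ card P * B"
  using P c B X
proof (induction P arbitrary: X rule: finite_induct)
  case empty
  then show ?case by (simp)
next
  case (insert p P)
  define S where "S Y = {n \<in> below Y. \<forall>p\<in>P. \<not> int p dvd n}" for Y
  define e where "e = (\<Prod>p\<in>P. 1 - 1 / real p)"
  have p: "prime p" using insert.prems by auto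
  have p1: "real p \<ge> 1" using prime_gt_0_nat[OF p] by simp
  have IH: "\<bar>(\<Sum>n\<in>S Y. f n) - c * Y * e\<bar> \<le> 2 ^ card P * B" if "0 < Y" "Y \<le> X" for Y
    unfolding S_def e_def
    by (rule insert.IH) (use insert.prems that in auto)
  have pd: "int p' dvd int p * m \<longleftrightarrow> int p' dvd m" if "p' \<in> P" for p' m
  proof -
    have "prime p'" "p' \<noteq> p" using that insert by auto
    then have "coprime (int p') (int p)" using p by (simp add: primes_coprime)
    then show ?thesis by (simp add: coprime_dvd_mult_right_iff)
  qed
  have im: "{n \<in> S X. int p dvd n} = (\<lambda>m. int p * m) ` S (X / real p)"
  proof (intro equalityI subsetI)
    fix n assume "n \<in> {n \<in> S X. int p dvd n}"
    then obtain m where "n = int p * m" "int p * m \<in> S X" by (auto elim: dvdE)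
    then show "n \<in> (\<lambda>m. int p * m) ` S (X / real p)"
      using p1 pd by (auto simp: S_def below_def field_simps zero_less_mult_iff)
  next
    fix n assume "n \<in> (\<lambda>m. int p * m) ` S (X / real p)"
    then show "n \<in> {n \<in> S X. int p dvd n}"
      using p1 pd by (auto simp: S_def below_def field_simps zero_less_mult_iff)
  qed
  have fin: "finite (S Y)" for Y by (simp add: S_def)
  have "{n \<in> below X. \<forall>p\<in>insert p P. \<not> int p dvd n} = S X - {n \<in> S X. int p dvd n}"
    by (auto simp: S_def)
  then have "(\<Sum>n\<in>{n \<in> below X. \<forall>p\<in>insert p P. \<not> int p dvd n}. f n)
      = (\<Sum>n\<in>S X. f n) - (\<Sum>n\<in>{n \<in> S X. int p dvd n}. f n)"
    using fin by (simp add: sum_diff)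
  also have "(\<Sum>n\<in>{n \<in> S X. int p dvd n}. f n) = f (int p) * (\<Sum>n\<in>S (X / real p). f n)"
    unfolding im using p1 by (subst sum.reindex) (auto simp: inj_on_def f(1) sum_distrib_left)
  finally have "(\<Sum>n\<in>{n \<in> below X. \<forall>p\<in>insert p P. \<not> int p dvd n}. f n)
      - c * X * (\<Prod>p\<in>insert p P. 1 - 1 / real p)
    = ((\<Sum>n\<in>S X. f n) - c * X * e) - f (int p) * ((\<Sum>n\<in>S (X / real p). f n) - c * (X / real p) * e)"
    using insert.hyps insert.prems(2)[of p] by (simp add: e_def[symmetric] algebra_simps) blast
  also have "\<bar>\<dots>\<bar> \<le> \<bar>(\<Sum>n\<in>S X. f n) - c * X * e\<bar> + 1 * \<bar>(\<Sum>n\<in>S (X / real p). f n) - c * (X / real p) * e\<bar>"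
    by (rule order_trans[OF abs_triangle_ineq4]) (auto simp: abs_mult intro!: mult_left_le_one_le f(2))
  also have "\<dots> \<le> 2 ^ card P * B + 1 * (2 ^ card P * B)"
    using insert.prems(4) p1 by (intro add_mono mult_left_mono IH) (auto simp: field_simps)
  also have "\<dots> = 2 ^ card (insert p P) * B" using insert.hyps by simp
  finally show ?case .
qed

lemma coprime_iff_prime_factors:
  assumes "s > 0"
  shows "coprime n (int s) \<longleftrightarrow> (\<forall>p\<in>prime_factors s. \<not> int p dvd n)"
proof
  assume c: "coprime n (int s)"
  show "\<forall>p\<in>prime_factors s. \<not> int p dvd n"
  proof (intro ballI notI)
    fix p assume p: "p \<in> prime_factors s" "int p dvd n"
    then have "p dvd s" "prime p" by auto
    then show False using c p(2) coprime_common_divisor[of n "int s" "int p"] by auto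
  qed
next
  assume *: "\<forall>p\<in>prime_factors s. \<not> int p dvd n"
  show "coprime n (int s)"
  proof (rule ccontr)
    assume "\<not> coprime n (int s)"
    then have "\<not> coprime (nat \<bar>n\<bar>) s" by (simp add: coprime_nat_abs_left_iff)
    then have "gcd (nat \<bar>n\<bar>) s \<noteq> 1" by (simp only: coprime_iff_gcd_eq_1 not_False_eq_True)
    then obtain p where pg: "prime p" "p dvd gcd (nat \<bar>n\<bar>) s"
      using prime_factor_nat by blast
    have p: "p dvd s" "p dvd nat \<bar>n\<bar>"
      using dvd_trans[OF pg(2) gcd_dvd2] dvd_trans[OF pg(2) gcd_dvd1] by auto
    then have "p \<in> prime_factors s" using assms pg(1) by (simp add: prime_factors_dvd)
    then show False using * p(2) by (simp add: dvd_nat_abs_iff)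
  qed
qed

text \<open>For \<open>a \<le> q\<close> put \<open>e = gcd a r\<close>, \<open>b = a / e\<close> and let \<open>n\<close> be the residue of \<open>b\<^sup>2\<close> modulo
  \<open>q / e\<^sup>2\<close> nearest to 0.\<close>
lemma A_count_le_square_roots:
  fixes q :: nat and \<delta> :: real
  assumes q: "q > 0" and \<delta>: "\<delta> > 0"
  defines "r \<equiv> largest_square_root_divisor q"
  shows "real (A_count q \<delta>) \<le> (\<Sum>e\<in>{e. e dvd r}.
    \<Sum>n\<in>{n. \<bar>real_of_int n\<bar> < \<delta> * q / (real e)\<^sup>2 \<and> coprime n (int (r div e))}.
      4 * real e * (\<Prod>p\<in>odd_prime_divisors (q div e\<^sup>2). 1 + chi {p} n))"
proof -
  have r2: "r\<^sup>2 dvd q" and rmax: "\<And>s. s\<^sup>2 dvd q \<Longrightarrow> s \<le> r"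
    using largest_square_root_divisor[OF q] by (auto simp: r_def)
  have r0: "r > 0" using r2 q by (auto intro: Nat.gr0I)
  define Z where "Z e = {n. \<bar>real_of_int n\<bar> < \<delta> * q / (real e)\<^sup>2 \<and> coprime n (int (r div e))}" for e
  \<comment> \<open>Since \<open>b = a / e\<close> runs up to \<open>q / e\<close>, it covers
    \<open>e\<close> full periods of length \<open>q / e\<^sup>2\<close>; this is the origin of the
    weight \<open>e\<close>.\<close>
  define S where "S e n = {b \<in> {1..e * (q div e\<^sup>2)}. coprime b (r div e) \<and> [int b ^ 2 = n] (mod int (q div e\<^sup>2))}" for e n
  have finZ: "finite (Z e)" for e
    by (rule finite_subset[of _ "{- \<lceil>\<delta> * q / (real e)\<^sup>2\<rceil>..\<lceil>\<delta> * q / (real e)\<^sup>2\<rceil>}"])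
      (auto simp: Z_def, linarith+)
  have finD: "finite {e. e dvd r}" using r0 by simp
  have e2: "e\<^sup>2 dvd q" if "e dvd r" for e using that r2 dvd_trans[of "e\<^sup>2" "r\<^sup>2" q] by simp
  have "{a \<in> {1..q}. dist_nearest_int (real (a ^ 2) / real q) < \<delta>}
      \<subseteq> (\<Union>e\<in>{e. e dvd r}. \<Union>n\<in>Z e. (\<lambda>b. e * b) ` S e n)"
  proof
    fix a assume a: "a \<in> {a \<in> {1..q}. dist_nearest_int (real (a ^ 2) / real q) < \<delta>}"
    define e where "e = gcd a r"
    define q' where "q' = q div e\<^sup>2"
    define b where "b = a div e"
    define s where "s = r div e"
    have e: "e dvd r" "e dvd a" "e > 0" using r0 by (auto simp: e_def)
    have ab: "a = e * b" and qq: "q = e\<^sup>2 * q'" and rs: "r = e * s" using e e2[OF e(1)] by (simp_all add: b_def q'_def s_def)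
    have q'0: "q' > 0" using qq q by (auto intro: Nat.gr0I)
    have cop: "coprime b s" unfolding b_def s_def e_def using r0 by (intro div_gcd_coprime) auto
    define k where "k = round (real (a ^ 2) / real q)"
    define n where "n = int b ^ 2 - k * int q'"
    have n: "real_of_int n = real q' * (real (a ^ 2) / real q - k)"
      using e(3) q'0 by (simp add: n_def ab qq power_mult_distrib field_simps)
    have "\<bar>real_of_int n\<bar> = real q' * dist_nearest_int (real (a ^ 2) / real q)"
      unfolding n dist_nearest_int_def k_def by (simp add: abs_mult)
    also have "\<dots> < real q' * \<delta>" using a q'0 by simp
    also have "\<dots> = \<delta> * q / (real e)\<^sup>2" using e(3) by (simp add: qq)
    finally have 1: "\<bar>real_of_int n\<bar> < \<delta> * q / (real e)\<^sup>2" .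
    have "e\<^sup>2 * s\<^sup>2 dvd e\<^sup>2 * q'" using r2 by (simp add: rs qq power_mult_distrib)
    then have "s\<^sup>2 dvd q'" using e(3) by simp
    then have sq': "int s dvd int q'" by (simp add: power2_eq_square dvd_mult_left)
    have 2: "coprime n (int s)"
    proof -
      have "coprime (int b ^ 2) (int s)" using cop by simp
      moreover have "[n = int b ^ 2] (mod int s)"
        using sq' by (simp add: n_def cong_iff_dvd_diff)
      ultimately show ?thesis using cong_imp_coprime cong_sym by blast
    qed
    have "n \<in> Z e" using 1 2 by (simp add: Z_def s_def)
    moreover have "b \<in> S e n"
    proof -
      have "e * b \<le> e * (e * q')" using a by (simp add: ab qq power2_eq_square mult.assoc)
      then have "b \<le> e * q'" using e(3) by simp
      moreover have "b \<ge> 1" using a ab by (cases b) auto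
      moreover have "[int b ^ 2 = n] (mod int q')" by (simp add: n_def cong_iff_dvd_diff)
      ultimately show ?thesis using cop by (simp add: S_def q'_def s_def)
    qed
    ultimately show "a \<in> (\<Union>e\<in>{e. e dvd r}. \<Union>n\<in>Z e. (\<lambda>b. e * b) ` S e n)"
      using ab e(1) by blast
  qed
  then have "A_count q \<delta> \<le> card (\<Union>e\<in>{e. e dvd r}. \<Union>n\<in>Z e. (\<lambda>b. e * b) ` S e n)"
    unfolding A_count_def using finZ finD by (intro card_mono) (auto simp: S_def)
  also have "\<dots> \<le> (\<Sum>e\<in>{e. e dvd r}. card (\<Union>n\<in>Z e. (\<lambda>b. e * b) ` S e n))"
    by (rule card_UN_le[OF finD])
  also have "\<dots> \<le> (\<Sum>e\<in>{e. e dvd r}. \<Sum>n\<in>Z e. card ((\<lambda>b. e * b) ` S e n))"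
    by (intro sum_mono card_UN_le finZ)
  also have "\<dots> \<le> (\<Sum>e\<in>{e. e dvd r}. \<Sum>n\<in>Z e. card (S e n))"
    by (intro sum_mono card_image_le) (simp add: S_def)
  finally have "real (A_count q \<delta>) \<le> (\<Sum>e\<in>{e. e dvd r}. \<Sum>n\<in>Z e. real (card (S e n)))"
    by (simp flip: of_nat_sum)
  also have "\<dots> \<le> (\<Sum>e\<in>{e. e dvd r}. \<Sum>n\<in>Z e. 4 * real e * (\<Prod>p\<in>odd_prime_divisors (q div e\<^sup>2). 1 + chi {p} n))"
  proof (intro sum_mono)
    fix e n assume "e \<in> {e. e dvd r}"
    then have e: "e dvd r" by simp
    define q' where "q' = q div e\<^sup>2"
    define s where "s = r div e"
    have qq: "q = e\<^sup>2 * q'" and rs: "r = e * s" using e e2[OF e] by (simp_all add: q'_def s_def)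
    have q'0: "q' > 0" and e0: "e > 0" using qq q by (auto intro: Nat.gr0I)
    \<comment> \<open>Otherwise \<open>(p * r)\<^sup>2\<close> would divide \<open>q\<close>,
      against the maximality of \<open>r\<close>.\<close>
    have "p dvd s" if p: "prime p" "p\<^sup>2 dvd q'" for p
    proof (rule ccontr)
      assume "\<not> p dvd s"
      then have "coprime (p\<^sup>2) (s\<^sup>2)" using p(1) by (simp add: prime_imp_coprime)
      moreover have "e\<^sup>2 * s\<^sup>2 dvd e\<^sup>2 * q'" using r2 by (simp add: rs qq power_mult_distrib)
      then have "s\<^sup>2 dvd q'" using e0 by simp
      ultimately have "p\<^sup>2 * s\<^sup>2 dvd q'" using p(2) by (simp add: divides_mult)
      then have "(p * r)\<^sup>2 dvd q" by (simp add: rs qq power_mult_distrib mult.left_commute)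
      then have "p * r \<le> r" by (rule rmax)
      then show False using r0 prime_gt_1_nat[OF p(1)] by simp
    qed
    then show "real (card (S e n)) \<le> 4 * real e * (\<Prod>p\<in>odd_prime_divisors (q div e\<^sup>2). 1 + chi {p} n)"
      using card_square_roots_le[OF q'0, of s e n] by (simp add: S_def q'_def s_def)
  qed
  finally show ?thesis by (simp only: Z_def)
qed

section \<open>Weighted sums over short intervals\<close>

text \<open>The factors \<open>1\<close> and \<open>-1\<close> are left in place so that both halves
  are instances of one estimate with a sign \<open>\<sigma>\<close>. The term at 0, weighted by
  \<open>e\<close> and summed over the divisors of \<open>r\<close>, later becomes part of
  \<open>r powr (1 + \<epsilon>)\<close>.\<close>

lemma sum_symmetric_le:
  fixes W :: "int \<Rightarrow> real"
  assumes "\<And>n. W n \<ge> 0" "s > 0"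
  shows "(\<Sum>n\<in>{n. \<bar>real_of_int n\<bar> < X \<and> coprime n (int s)}. W n)
    \<le> W 0 + (\<Sum>n\<in>{n \<in> below X. \<forall>p\<in>prime_factors s. \<not> int p dvd n}. W (1 * n))
        + (\<Sum>n\<in>{n \<in> below X. \<forall>p\<in>prime_factors s. \<not> int p dvd n}. W ((-1) * n))"
proof -
  define Z where "Z = {n \<in> below X. \<forall>p\<in>prime_factors s. \<not> int p dvd n}"
  have Z: "Z = {n \<in> below X. coprime n (int s)}"
    unfolding Z_def coprime_iff_prime_factors[OF assms(2)] ..
  have fin: "finite Z" by (simp add: Z_def)
  have "{n. \<bar>real_of_int n\<bar> < X \<and> coprime n (int s)} \<subseteq> {0} \<union> (Z \<union> uminus ` Z)"
  proof
    fix n assume n: "n \<in> {n. \<bar>real_of_int n\<bar> < X \<and> coprime n (int s)}"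
    consider "n = 0" | "n > 0" | "n < 0" by linarith
    then show "n \<in> {0} \<union> (Z \<union> uminus ` Z)"
    proof cases
      case 3
      then have "- n \<in> Z" using n by (simp add: Z below_def)
      then have "- (- n) \<in> uminus ` Z" by (rule imageI)
      then show ?thesis by simp
    qed (use n in \<open>auto simp: Z below_def\<close>)
  qed
  then have "(\<Sum>n\<in>{n. \<bar>real_of_int n\<bar> < X \<and> coprime n (int s)}. W n) \<le> (\<Sum>n\<in>{0} \<union> (Z \<union> uminus ` Z). W n)"
    using fin assms(1) by (intro sum_mono2) auto
  also have "\<dots> \<le> (\<Sum>n\<in>{0}. W n) + (\<Sum>n\<in>Z \<union> uminus ` Z. W n)"
    using fin assms(1) sum.union_inter[of "{0}" "Z \<union> uminus ` Z" W] sum_nonneg[of "{0} \<inter> (Z \<union> uminus ` Z)" W] by fastforce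
  also have "(\<Sum>n\<in>Z \<union> uminus ` Z. W n) \<le> (\<Sum>n\<in>Z. W n) + (\<Sum>n\<in>uminus ` Z. W n)"
    using fin assms(1) sum.union_inter[of Z "uminus ` Z" W] sum_nonneg[of "Z \<inter> uminus ` Z" W] by fastforce
  also have "(\<Sum>n\<in>uminus ` Z. W n) = (\<Sum>n\<in>Z. W ((-1) * n))"
    by (subst sum.reindex) (auto simp: inj_on_def)
  finally show ?thesis by (simp add: Z_def)
qed

lemma prod_odd_prime_divisors_dvd:
  assumes "q > 0" "T \<subseteq> odd_prime_divisors q"
  shows "\<Prod>T dvd q"
proof -
  have "finite T" using odd_primes_subset[OF odd_primes_odd_prime_divisors[OF assms(1)] assms(2)]
    by (simp add: odd_primes_def)
  then show ?thesis using assms(2)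
  proof (induction T rule: finite_induct)
    case (insert p T)
    have "coprime p (\<Prod>T)"
      using insert by (intro prod_coprime_right primes_coprime_nat) (auto simp: odd_prime_divisors_def)
    moreover have "p dvd q" using insert by (auto simp: odd_prime_divisors_def)
    ultimately have "p * \<Prod>T dvd q" using insert by (intro divides_mult) auto
    then show ?case using insert by simp
  qed simp
qed

text \<open>A nontrivial character sum is estimated by the geometric mean of the trivial bound
  \<open>X\<close> and the bound \<open>B0\<close>, not by \<open>B0\<close> alone. In the
  application \<open>X = N / e\<^sup>2\<close> and the sum carries the weight \<open>e\<close>,
  which the root absorbs exactly: \<open>e * sqrt (X * B0) = sqrt (N * B0)\<close>. For this purpose
  \<open>B0\<close> is formed with \<open>N\<close> instead of \<open>X\<close>.\<close>

lemma sieved_weight_sum: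
  fixes Q X N :: real and s :: nat and \<sigma> :: int
  assumes P: "odd_primes P" "real (\<Prod>P) \<le> Q" and Q: "Q \<ge> 1" and s: "s > 0" and X: "0 < X" "X \<le> N"
  defines "B0 \<equiv> N * (12 ^ card P / Q powr (1/48)) powr (1/8) + 6 * Q powr (35/96)"
  shows "(\<Sum>n\<in>{n \<in> below X. \<forall>p\<in>prime_factors s. \<not> int p dvd n}. \<Prod>p\<in>P. 1 + chi {p} (\<sigma> * n))
    \<le> 2 ^ 96 * (X * (totient s / real s) + 2 ^ card (prime_factors s)
        + 2 ^ card P * 2 ^ card (prime_factors s) * sqrt (X * B0))"
proof -
  define Z where "Z = {n \<in> below X. \<forall>p\<in>prime_factors s. \<not> int p dvd n}"
  define w where "w = card (prime_factors s)"
  define z where "z = Q powr (1/96)"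
  define Ps where "Ps = {p \<in> P. real p \<le> z}"
  define Pb where "Pb = {p \<in> P. \<not> real p \<le> z}"
  have finP: "finite P" and pP: "\<And>p. p \<in> P \<Longrightarrow> prime p" using P(1) by (auto simp: odd_primes_def)
  have fin: "finite Ps" "finite Pb" and un: "P = Ps \<union> Pb" "Ps \<inter> Pb = {}"
    using finP by (auto simp: Ps_def Pb_def)
  have z1: "z \<ge> 1" using Q by (simp add: z_def ge_one_powr_ge_zero)
  have pos: "real (\<Prod>T) \<ge> 1" if "T \<subseteq> P" for T
    using odd_primes_prod_pos[OF odd_primes_subset[OF P(1) that]] by (simp del: of_nat_prod)
  have sub_le: "real (\<Prod>T) \<le> Q" if "T \<subseteq> P" for T
  proof -
    have "\<Prod>P = \<Prod>T * \<Prod>(P - T)" using finP that by (metis prod.subset_diff mult.commute)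
    then have "real (\<Prod>T) * 1 \<le> real (\<Prod>P)"
      using pos[of "P - T"] by (simp only: of_nat_mult) (intro mult_left_mono, auto intro: prod_nonneg)
    then show ?thesis using P(2) by simp
  qed
  \<comment> \<open>These primes exceed \<open>z\<close> and their product is at most
    \<open>Q = z ^ 96\<close>. Comparing exponents needs \<open>z > 1\<close>, which holds as soon
    as there is such a prime.\<close>
  have big: "card Pb \<le> 96"
  proof (cases "Pb = {}")
    case False
    then obtain p0 where p0: "p0 \<in> Pb" by blast
    have "real p0 \<le> Q" using sub_le[of "{p0}"] p0 by (simp add: Pb_def)
    then have "Q > 1" using p0 z1 by (simp add: Pb_def)
    then have zgt: "z > 1" by (simp add: z_def gr_one_powr)
    have "z ^ card Pb = (\<Prod>p\<in>Pb. z)" by simp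
    also have "\<dots> \<le> (\<Prod>p\<in>Pb. real p)" using z1 by (intro prod_mono) (auto simp: Pb_def)
    also have "\<dots> \<le> Q" using sub_le[of Pb] by (simp add: Pb_def)
    also have "\<dots> = z ^ 96" using Q by (simp add: z_def powr_power)
    finally show ?thesis using zgt by (simp add: power_le_imp_le_exp)
  qed simp
  have nn: "0 \<le> 1 + chi {p} n" "1 + chi {p} n \<le> 2" for p n using abs_chi_le[of "{p}" n] by linarith+
  have sq: "0 \<le> sqrt (X * B0)" using X Q by (simp add: B0_def)
  have per_n: "(\<Prod>p\<in>P. 1 + chi {p} (\<sigma> * n)) \<le> 2 ^ 96 * (\<Sum>T\<in>Pow Ps. chi T \<sigma> * chi T n)" for n
  proof -
    have prods: "(\<Prod>p\<in>Ps. 1 + chi {p} (\<sigma> * n)) = (\<Sum>T\<in>Pow Ps. chi T \<sigma> * chi T n)"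
    proof -
      have "(\<Prod>p\<in>Ps. chi {p} (\<sigma> * n) + 1) = (\<Sum>T\<in>Pow Ps. (\<Prod>p\<in>T. chi {p} (\<sigma> * n)) * (\<Prod>p\<in>Ps - T. 1))"
        by (rule prod_add[OF fin(1)])
      also have "\<dots> = (\<Sum>T\<in>Pow Ps. chi T \<sigma> * chi T n)"
      proof (intro sum.cong refl)
        fix T assume "T \<in> Pow Ps"
        then have "odd_primes T" using odd_primes_subset[OF P(1), of T] by (auto simp: Ps_def)
        then show "(\<Prod>p\<in>T. chi {p} (\<sigma> * n)) * (\<Prod>p\<in>Ps - T. 1) = chi T \<sigma> * chi T n"
          by (simp add: chi_mult[symmetric]) (simp add: chi_def)
      qed
      finally show ?thesis by (simp add: add.commute)
    qed
    have "(\<Prod>p\<in>P. 1 + chi {p} (\<sigma> * n)) = (\<Prod>p\<in>Ps. 1 + chi {p} (\<sigma> * n)) * (\<Prod>p\<in>Pb. 1 + chi {p} (\<sigma> * n))"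
      by (subst un(1)) (rule prod.union_disjoint[OF fin un(2)])
    \<comment> \<open>Bounding the large primes trivially is possible here because the product over
      the small ones is still nonnegative; after the expansion the terms may have either
      sign.\<close>
    also have "\<dots> \<le> (\<Prod>p\<in>Ps. 1 + chi {p} (\<sigma> * n)) * 2 ^ 96"
    proof (rule mult_left_mono)
      have "(\<Prod>p\<in>Pb. 1 + chi {p} (\<sigma> * n)) \<le> (\<Prod>p\<in>Pb. 2)" by (rule prod_mono) (use nn in auto)
      also have "\<dots> = 2 ^ card Pb" by simp
      also have "\<dots> \<le> 2 ^ 96" by (rule power_increasing[OF big]) simp
      finally show "(\<Prod>p\<in>Pb. 1 + chi {p} (\<sigma> * n)) \<le> 2 ^ 96" .
    qed (use nn in \<open>auto intro: prod_nonneg\<close>)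
    finally show ?thesis by (simp only: prods mult.commute)
  qed
  have main: "(\<Sum>n\<in>Z. chi {} n) \<le> X * (totient s / real s) + 2 ^ w"
  proof -
    have "\<bar>(\<Sum>n\<in>{n \<in> below X. \<forall>p\<in>prime_factors s. \<not> int p dvd n}. 1) - 1 * X * (\<Prod>p\<in>prime_factors s. 1 - 1 / real p)\<bar>
        \<le> 2 ^ card (prime_factors s) * 1"
      by (rule sieved_sum) (use X card_below_approx in auto)
    moreover have "(\<Prod>p\<in>prime_factors s. 1 - 1 / real p) = totient s / real s"
      using s totient_formula2[of s] by simp
    ultimately show ?thesis by (simp add: Z_def w_def abs_le_iff)
  qed
  have other: "chi T \<sigma> * (\<Sum>n\<in>Z. chi T n) \<le> 2 ^ w * sqrt (X * B0)" if T: "T \<subseteq> Ps" "T \<noteq> {}" for T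
  proof -
    have TP: "T \<subseteq> P" using T by (auto simp: Ps_def)
    have opT: "odd_primes T" by (rule odd_primes_subset[OF P(1) TP])
    have B: "\<bar>(\<Sum>n\<in>below Y. chi T n) - 0 * Y\<bar> \<le> sqrt (X * B0)" if Y: "0 < Y" "Y \<le> X" for Y
    proof -
      define S where "S = \<bar>\<Sum>n\<in>below Y. chi T n\<bar>"
      have "S \<le> (\<Sum>n\<in>below Y. 1)" unfolding S_def by (intro order_trans[OF sum_abs] sum_mono abs_chi_le)
      also have "\<dots> \<le> X" using card_below_le[OF Y(1)] Y by simp
      finally have 1: "S \<le> X" .
      have L: "\<lceil>Y\<rceil> - 1 \<ge> 0" "of_int (\<lceil>Y\<rceil> - 1) \<le> N" using Y X by linarith+
      have "S \<le> of_int (\<lceil>Y\<rceil> - 1) * (12 ^ card T / Q powr (1/48)) powr (1/8) + 6 * Q powr (35/96)"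
        unfolding S_def below_eq
        using T opT sub_le[OF TP] Q L by (intro smooth_character_sum) (auto simp: Ps_def z_def)
      also have "\<dots> \<le> B0"
        unfolding B0_def using L Q X card_mono[OF finP TP]
        by (intro add_mono mult_mono powr_mono2 divide_right_mono power_increasing) auto
      finally have 2: "S \<le> B0" .
      have "S * S \<le> X * B0" using 1 2 X by (intro mult_mono) (auto simp: S_def)
      then have "S \<le> sqrt (X * B0)" by (intro real_le_rsqrt) (simp add: power2_eq_square)
      then show ?thesis by (simp add: S_def)
    qed
    have "\<bar>(\<Sum>n\<in>{n \<in> below X. \<forall>p\<in>prime_factors s. \<not> int p dvd n}. chi T n) - 0 * X * (\<Prod>p\<in>prime_factors s. 1 - 1 / real p)\<bar>
        \<le> 2 ^ card (prime_factors s) * sqrt (X * B0)"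
      by (rule sieved_sum[OF _ _ _ _ _ B X(1)]) (auto simp: chi_mult[OF opT] abs_chi_le)
    then have "\<bar>\<Sum>n\<in>Z. chi T n\<bar> \<le> 2 ^ w * sqrt (X * B0)" by (simp add: Z_def w_def)
    moreover have "\<bar>chi T \<sigma> * (\<Sum>n\<in>Z. chi T n)\<bar> \<le> \<bar>\<Sum>n\<in>Z. chi T n\<bar>"
      by (simp add: abs_mult mult_left_le_one_le abs_chi_le)
    ultimately show ?thesis by linarith
  qed
  have "(\<Sum>n\<in>Z. \<Prod>p\<in>P. 1 + chi {p} (\<sigma> * n)) \<le> (\<Sum>n\<in>Z. 2 ^ 96 * (\<Sum>T\<in>Pow Ps. chi T \<sigma> * chi T n))"
    by (intro sum_mono per_n)
  also have "\<dots> = 2 ^ 96 * (\<Sum>T\<in>Pow Ps. chi T \<sigma> * (\<Sum>n\<in>Z. chi T n))"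
    unfolding sum_distrib_left by (rule sum.swap)
  also have "(\<Sum>T\<in>Pow Ps. chi T \<sigma> * (\<Sum>n\<in>Z. chi T n))
      = (\<Sum>n\<in>Z. chi {} n) + (\<Sum>T\<in>Pow Ps - {{}}. chi T \<sigma> * (\<Sum>n\<in>Z. chi T n))"
    using fin by (subst sum.remove[of _ "{}"]) auto
  also have "\<dots> \<le> (X * (totient s / real s) + 2 ^ w) + (\<Sum>T\<in>Pow Ps - {{}}. 2 ^ w * sqrt (X * B0))"
    by (intro add_mono main sum_mono other) auto
  also have "(\<Sum>T\<in>Pow Ps - {{}}. 2 ^ w * sqrt (X * B0)) \<le> 2 ^ card P * (2 ^ w * sqrt (X * B0))"
  proof -
    have "card (Pow Ps - {{}}) \<le> card (Pow P)" using finP by (intro card_mono) (auto simp: Ps_def)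
    then have "real (card (Pow Ps - {{}})) \<le> real (2 ^ card P)"
      using finP by (simp only: card_Pow of_nat_le_iff)
    then show ?thesis using sq by (simp add: mult_right_mono)
  qed
  finally show ?thesis by (simp add: Z_def w_def mult.assoc)
qed

section \<open>Assembling the estimate\<close>

theorem theorem4:
  fixes \<epsilon> :: real
  assumes "\<epsilon> > 0"
  shows "\<exists>C>0. \<forall>(q::nat) (\<delta>::real) (r::nat).
           q > 0 \<and> 0 < \<delta> \<and> \<delta> < 1/2 \<and> r = largest_square_root_divisor q \<longrightarrow>
           real (A_count q \<delta>) \<le>
             C * (\<delta> * real q + real r powr (1 + \<epsilon>) + \<delta> powr (1/2) * real q powr (11/16 + \<epsilon>))"
proof -
  \<comment> \<open>Two bounds with exponent \<open>\<kappa>\<close> get multiplied, hence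
    \<open>\<epsilon> / 2\<close>. For large \<open>N\<close> their product must not exceed the
    saving \<open>q powr (1/1536)\<close>, and \<open>1 / 4000\<close> is below half of that
    exponent.\<close>
  define \<kappa> where "\<kappa> = min (\<epsilon> / 2) (1 / 4000)"
  have \<kappa>: "\<kappa> > 0" "2 * \<kappa> \<le> \<epsilon>" "\<kappa> \<le> \<epsilon>" "2 * \<kappa> \<le> 1 / 1536" using assms by (auto simp: \<kappa>_def)
  obtain C1 where C1: "C1 > 0" "\<And>n. n > 0 \<Longrightarrow> real (card {d. d dvd n}) \<le> C1 * real n powr \<kappa>"
    using divisor_bound[OF \<kappa>(1)] by blast
  obtain C2 where C2: "C2 > 0" "\<And>n. n > 0 \<Longrightarrow> 4 ^ card (prime_factors n) \<le> C2 * real n powr \<kappa>"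
    using prime_omega_bound[OF \<kappa>(1), of 4] by auto
  \<comment> \<open>The exponent 1/96 is half of the 1/48 at disposal:
    \<open>12 ^ w / q powr (1/48)\<close> stays below \<open>C3 * q powr (- 1/96)\<close>. The
    eighth root saves \<open>q powr (1/768)\<close>, and the geometric mean halves this to
    1/1536.\<close>
  obtain C3 where C3: "C3 > 0" "\<And>n. n > 0 \<Longrightarrow> 12 ^ card (prime_factors n) \<le> C3 * real n powr (1/96)"
    using prime_omega_bound[of "1/96" 12] by auto
  define C4 where "C4 = C3 powr (1/8) + 6"
  have C4: "C4 > 0" by (simp add: C4_def add_nonneg_pos)
  \<comment> \<open>The power \<open>2 ^ 99\<close> consists of \<open>2 ^ 96\<close> for the
    discarded primes, 4 for the square roots and 2 for the two signs. The summand
    \<open>8 * (C1 * C2)\<close> serves small \<open>N\<close>, the one with \<open>2 ^ 99\<close>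
    large \<open>N\<close>, and \<open>4 * C1\<close> the terms at 0 in both ranges.\<close>
  define C where "C = 4 * C1 + 8 * (C1 * C2) + 2 ^ 99 * (1 + C1 * C2 + C1 * C2 * sqrt C4)"
  have C_pos: "C > 0" using C1 C2 C4 by (simp add: C_def add_pos_pos)
  show ?thesis
  proof (intro exI[of _ C] conjI allI impI)
    show "C > 0" by (rule C_pos)
    fix q :: nat and \<delta> :: real and r :: nat
    assume asm: "q > 0 \<and> 0 < \<delta> \<and> \<delta> < 1/2 \<and> r = largest_square_root_divisor q"
    then have q: "q > 0" and \<delta>: "\<delta> > 0" and r: "r = largest_square_root_divisor q" by auto
    have r2: "r\<^sup>2 dvd q" using largest_square_root_divisor(1)[OF q] by (simp add: r)
    have r0: "r > 0" using r2 q by (auto intro: Nat.gr0I)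
    have rq: "r dvd q" using r2 by (simp add: power2_eq_square dvd_mult_left)
    have r_le: "r \<le> q" using rq q by (rule dvd_imp_le)
    define N where "N = \<delta> * real q"
    define w where "w = card (prime_factors q)"
    define wr where "wr = card (prime_factors r)"
    define D where "D = {e. e dvd r}"
    define \<tau> where "\<tau> = real (card D)"
    define Z where "Z X s = {n \<in> below X. \<forall>p\<in>prime_factors s. \<not> int p dvd n}" for X s
    define W where "W e n = (\<Prod>p\<in>odd_prime_divisors (q div e\<^sup>2). 1 + chi {p} n)" for e n
    define X where "X e = N / (real e)\<^sup>2" for e :: nat
    have N: "N > 0" using \<delta> q by (simp add: N_def)
    have finD: "finite D" using r0 by (simp add: D_def)
    have \<tau>: "\<tau> \<le> C1 * real r powr \<kappa>" using C1(2)[OF r0] by (simp add: \<tau>_def D_def)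
    have \<tau>0: "\<tau> \<ge> 0" by (simp add: \<tau>_def)
    have \<tau>q: "\<tau> \<le> C1 * real q powr \<kappa>"
      using \<tau> C1(1) \<kappa> r_le by (elim order_trans) (intro mult_left_mono powr_mono2, auto)
    have r_pow: "real r * real r powr x \<le> real r powr (1 + \<epsilon>)" if "x \<le> \<epsilon>" for x
      using r0 that powr_mono[of "1 + x" "1 + \<epsilon>" "real r"] by (simp add: powr_add)
    have w4: "(2::real) ^ n \<le> 4 ^ n" for n by (rule power_mono) auto
    have dec: "e > 0" "q div e\<^sup>2 > 0" "q div e\<^sup>2 dvd q" "r div e > 0" "r div e dvd r" "real (r div e) = real r / real e" "e \<le> r"
      if "e \<in> D" for e
    proof -
      have e: "e dvd r" using that by (simp add: D_def)
      then have e2: "e\<^sup>2 dvd q" using r2 dvd_trans[of "e\<^sup>2" "r\<^sup>2" q] by simp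
      show "e > 0" using e r0 by (auto intro: Nat.gr0I)
      show "q div e\<^sup>2 > 0" using e2 q by (metis dvd_div_eq_0_iff gr0I less_numeral_extra(3))
      show "q div e\<^sup>2 dvd q" using e2 by (metis dvd_div_mult_self dvd_triv_left)
      show "r div e > 0" using e r0 by (metis dvd_div_eq_0_iff gr0I less_numeral_extra(3))
      show "r div e dvd r" using e by (metis dvd_div_mult_self dvd_triv_left)
      show "real (r div e) = real r / real e" using e by (rule real_of_nat_div)
      show "e \<le> r" using e r0 by (rule dvd_imp_le)
    qed
    have card_P: "card (odd_prime_divisors (q div e\<^sup>2)) \<le> w" if "e \<in> D" for e
      unfolding w_def
    proof (rule card_mono)
      show "odd_prime_divisors (q div e\<^sup>2) \<subseteq> prime_factors q"
        using dec(3)[OF that] q by (auto simp: odd_prime_divisors_def prime_factors_dvd intro: dvd_trans)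
    qed simp
    have W_nonneg: "W e n \<ge> 0" for e n
      unfolding W_def
    proof (rule prod_nonneg)
      fix p show "0 \<le> 1 + chi {p} n" using abs_chi_le[of "{p}" n] by linarith
    qed
    have W_0: "W e 0 = 1" for e by (simp add: W_def chi_def Legendre_def)
    have "real (A_count q \<delta>) \<le> (\<Sum>e\<in>D. \<Sum>n\<in>{n. \<bar>real_of_int n\<bar> < X e \<and> coprime n (int (r div e))}. 4 * real e * W e n)"
      using A_count_le_square_roots[OF q \<delta>] by (simp only: D_def X_def N_def W_def r)
    also have "\<dots> = (\<Sum>e\<in>D. 4 * real e * (\<Sum>n\<in>{n. \<bar>real_of_int n\<bar> < X e \<and> coprime n (int (r div e))}. W e n))"
      by (simp only: sum_distrib_left)
    also have "\<dots> \<le> (\<Sum>e\<in>D. 4 * real e * (1 + (\<Sum>n\<in>Z (X e) (r div e). W e (1 * n)) + (\<Sum>n\<in>Z (X e) (r div e). W e ((-1) * n))))"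
    proof (intro sum_mono mult_left_mono)
      fix e assume e: "e \<in> D"
      show "(\<Sum>n\<in>{n. \<bar>real_of_int n\<bar> < X e \<and> coprime n (int (r div e))}. W e n)
        \<le> 1 + (\<Sum>n\<in>Z (X e) (r div e). W e (1 * n)) + (\<Sum>n\<in>Z (X e) (r div e). W e ((-1) * n))"
        using sum_symmetric_le[of "W e" "r div e" "X e", OF W_nonneg dec(4)[OF e]] by (simp only: Z_def W_0)
    qed simp
    finally have A: "real (A_count q \<delta>) \<le> (\<Sum>e\<in>D. 4 * real e * (1 + (\<Sum>n\<in>Z (X e) (r div e). W e (1 * n)) + (\<Sum>n\<in>Z (X e) (r div e). W e ((-1) * n))))" .
    define R where "R = N + real r powr (1 + \<epsilon>) + \<delta> powr (1/2) * real q powr (11/16 + \<epsilon>)"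
    have "real (A_count q \<delta>) \<le> C * R"
    proof (cases "N < real q powr (3/8)")
      case True
      have triv: "(\<Sum>n\<in>Z (X e) (r div e). W e (\<sigma> * n)) \<le> 2 ^ w * X e" if e: "e \<in> D" for e \<sigma>
      proof -
        have "W e n \<le> 2 ^ w" for n
        proof -
          have "W e n \<le> (\<Prod>p\<in>odd_prime_divisors (q div e\<^sup>2). 2)"
            unfolding W_def
          proof (rule prod_mono)
            fix p show "0 \<le> 1 + chi {p} n \<and> 1 + chi {p} n \<le> 2" using abs_chi_le[of "{p}" n] by linarith
          qed
          also have "\<dots> \<le> 2 ^ w" using card_P[OF e] by simp
          finally show ?thesis .
        qed
        then have "(\<Sum>n\<in>Z (X e) (r div e). W e (\<sigma> * n)) \<le> (\<Sum>n\<in>Z (X e) (r div e). 2 ^ w)" by (intro sum_mono)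
        also have "\<dots> = 2 ^ w * real (card (Z (X e) (r div e)))" by simp
        also have "\<dots> \<le> 2 ^ w * real (card (below (X e)))"
          by (intro mult_left_mono of_nat_mono card_mono) (auto simp: Z_def)
        also have "\<dots> \<le> 2 ^ w * X e"
          using N dec(1)[OF e] by (intro mult_left_mono card_below_le) (auto simp: X_def)
        finally show ?thesis .
      qed
      have "real (A_count q \<delta>) \<le> (\<Sum>e\<in>D. 4 * real r + 8 * (2 ^ w * N))"
      proof (rule order_trans[OF A], rule sum_mono)
        fix e assume e: "e \<in> D"
        have e1: "real e \<ge> 1" using dec(1)[OF e] by simp
        have "4 * real e * (1 + (\<Sum>n\<in>Z (X e) (r div e). W e (1 * n)) + (\<Sum>n\<in>Z (X e) (r div e). W e ((-1) * n)))
          \<le> 4 * real e * (1 + 2 ^ w * X e + 2 ^ w * X e)"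
          by (intro mult_left_mono add_mono triv e) auto
        also have "\<dots> = 4 * real e + 8 * (2 ^ w * (N / real e))"
          using e1 by (simp add: X_def field_simps power2_eq_square)
        also have "\<dots> \<le> 4 * real r + 8 * (2 ^ w * N)"
          using dec(7)[OF e] e1 N by (intro add_mono mult_left_mono) (auto simp: divide_le_eq mult_le_cancel_left1)
        finally show "4 * real e * (1 + (\<Sum>n\<in>Z (X e) (r div e). W e (1 * n)) + (\<Sum>n\<in>Z (X e) (r div e). W e ((-1) * n)))
            \<le> 4 * real r + 8 * (2 ^ w * N)" .
      qed
      also have "\<dots> = 4 * (real r * \<tau>) + 8 * (\<tau> * 2 ^ w * N)" by (simp add: \<tau>_def algebra_simps)
      also have "real r * \<tau> \<le> C1 * real r powr (1 + \<epsilon>)"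
      proof -
        have "real r * \<tau> \<le> real r * (C1 * real r powr \<kappa>)" using \<tau> by (rule mult_left_mono) simp
        also have "\<dots> \<le> C1 * real r powr (1 + \<epsilon>)"
          using r_pow[OF \<kappa>(3)] C1(1) by (simp add: mult.left_commute)
        finally show ?thesis .
      qed
      also have "\<tau> * 2 ^ w * N \<le> (C1 * C2) * (\<delta> powr (1/2) * real q powr (11/16 + \<epsilon>))"
      proof -
        have "N = N powr (1/2) * N powr (1/2)" using N by (simp flip: powr_add)
        also have "\<dots> \<le> N powr (1/2) * (real q powr (3/8)) powr (1/2)"
          using True N by (intro mult_left_mono powr_mono2) auto
        also have "\<dots> = \<delta> powr (1/2) * real q powr (11/16)"
          using \<delta> q by (simp add: N_def powr_mult powr_powr mult.assoc flip: powr_add)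
        finally have N_le: "N \<le> \<delta> powr (1/2) * real q powr (11/16)" .
        have q_pow: "real q powr (11/16 + 2 * \<kappa>) = real q powr (11/16) * (real q powr \<kappa> * real q powr \<kappa>)"
          by (simp flip: powr_add)
        have "2 ^ w \<le> C2 * real q powr \<kappa>" using C2(2)[OF q] w4[of w] by (simp add: w_def)
        then have "\<tau> * 2 ^ w * N \<le> (C1 * real q powr \<kappa>) * (C2 * real q powr \<kappa>) * (\<delta> powr (1/2) * real q powr (11/16))"
          using \<tau>q \<tau>0 N_le N C1 C2 by (intro mult_mono) auto
        also have "\<dots> = (C1 * C2) * (\<delta> powr (1/2) * real q powr (11/16 + 2 * \<kappa>))"
          unfolding q_pow by (simp only: mult_ac)
        also have "\<dots> \<le> (C1 * C2) * (\<delta> powr (1/2) * real q powr (11/16 + \<epsilon>))"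
          using C1 C2 \<kappa> q by (intro mult_left_mono powr_mono) auto
        finally show ?thesis .
      qed
      finally have 1: "real (A_count q \<delta>) \<le> 4 * C1 * real r powr (1 + \<epsilon>)
          + 8 * (C1 * C2) * (\<delta> powr (1/2) * real q powr (11/16 + \<epsilon>))" by simp
      have "4 * C1 * real r powr (1 + \<epsilon>) \<le> 4 * C1 * R"
        using C1 N by (intro mult_left_mono) (auto simp: R_def)
      moreover have "8 * (C1 * C2) * (\<delta> powr (1/2) * real q powr (11/16 + \<epsilon>)) \<le> 8 * (C1 * C2) * R"
        using C1 C2 N by (intro mult_left_mono) (auto simp: R_def)
      moreover have "2 ^ 99 * (1 + C1 * C2 + C1 * C2 * sqrt C4) * R \<ge> 0"
        using C1 C2 C4 N by (auto simp: R_def intro!: mult_nonneg_nonneg add_nonneg_nonneg)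
      ultimately show ?thesis using 1 unfolding C_def distrib_right by linarith
    next
      case False
      define B where "B = N * (12 ^ w / real q powr (1/48)) powr (1/8) + 6 * real q powr (35/96)"
      have q1: "real q \<ge> 1" using q by simp
      have B0: "B \<ge> 0" using N by (simp add: B_def)
      have good: "(\<Sum>n\<in>Z (X e) (r div e). W e (\<sigma> * n))
          \<le> 2 ^ 96 * (X e * (totient (r div e) / real (r div e)) + 2 ^ wr + 4 ^ w * sqrt (X e * B))"
        if e: "e \<in> D" for e \<sigma>
      proof -
        let ?P = "odd_prime_divisors (q div e\<^sup>2)"
        define B' where "B' = N * (12 ^ card ?P / real q powr (1/48)) powr (1/8) + 6 * real q powr (35/96)"
        have Xe: "0 < X e" "X e \<le> N"
          using N dec(1)[OF e] by (auto simp: X_def divide_le_eq mult_le_cancel_left1)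
        have "\<Prod>?P dvd q"
          using prod_odd_prime_divisors_dvd[OF dec(2)[OF e], of ?P] dec(3)[OF e] dvd_trans by blast
        then have "real (\<Prod>?P) \<le> real q" using q by (simp only: of_nat_le_iff dvd_imp_le)
        then have "(\<Sum>n\<in>Z (X e) (r div e). W e (\<sigma> * n))
          \<le> 2 ^ 96 * (X e * (totient (r div e) / real (r div e)) + 2 ^ card (prime_factors (r div e))
            + 2 ^ card ?P * 2 ^ card (prime_factors (r div e)) * sqrt (X e * B'))"
          unfolding Z_def W_def B'_def
          by (intro sieved_weight_sum odd_primes_odd_prime_divisors dec(2,4)[OF e] q1 Xe)
        also have "\<dots> \<le> 2 ^ 96 * (X e * (totient (r div e) / real (r div e)) + 2 ^ wr + 4 ^ w * sqrt (X e * B))"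
        proof (intro mult_left_mono add_mono order_refl)
          have w1: "card (prime_factors (r div e)) \<le> wr"
            unfolding wr_def using dec(5)[OF e] r0 by (intro card_mono dvd_prime_factors) auto
          have w2: "wr \<le> w"
            unfolding wr_def w_def using rq q by (intro card_mono dvd_prime_factors) auto
          show "(2::real) ^ card (prime_factors (r div e)) \<le> 2 ^ wr" using w1 by simp
          have "(2::real) ^ card ?P * 2 ^ card (prime_factors (r div e)) \<le> 2 ^ w * 2 ^ w"
            using card_P[OF e] w1 w2 by (intro mult_mono) auto
          also have "\<dots> = 4 ^ w" by (simp flip: power_mult_distrib)
          finally have 4: "(2::real) ^ card ?P * 2 ^ card (prime_factors (r div e)) \<le> 4 ^ w" .
          have "B' \<le> B"
            unfolding B_def B'_def using N q card_P[OF e]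
            by (intro add_mono mult_left_mono powr_mono2 divide_right_mono power_increasing) auto
          then have "sqrt (X e * B') \<le> sqrt (X e * B)" using Xe by (simp add: mult_left_mono)
          then show "2 ^ card ?P * 2 ^ card (prime_factors (r div e)) * sqrt (X e * B') \<le> 4 ^ w * sqrt (X e * B)"
            using 4 N Xe by (intro mult_mono) (auto simp: B'_def)
        qed (use Xe in simp_all)
        finally show ?thesis .
      qed
      have "real (A_count q \<delta>) \<le> (\<Sum>e\<in>D. 4 * real r + 2 ^ 99 * (N / real r * totient (r div e) + real r * 2 ^ wr + 4 ^ w * sqrt (N * B)))"
      proof (rule order_trans[OF A], rule sum_mono)
        fix e assume e: "e \<in> D"
        have e1: "real e \<ge> 1" using dec(1)[OF e] by simp
        define G where "G = 2 ^ 96 * (X e * (totient (r div e) / real (r div e)) + 2 ^ wr + 4 ^ w * sqrt (X e * B))"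
        have "4 * real e * (1 + (\<Sum>n\<in>Z (X e) (r div e). W e (1 * n)) + (\<Sum>n\<in>Z (X e) (r div e). W e ((-1) * n)))
          \<le> 4 * real e * (1 + G + G)"
          unfolding G_def by (intro mult_left_mono add_mono good e) auto
        also have "\<dots> = 4 * real e + 2 ^ 99 * (real e * X e * (totient (r div e) / real (r div e)) + real e * 2 ^ wr + 4 ^ w * (real e * sqrt (X e * B)))"
          by (simp add: G_def algebra_simps)
        \<comment> \<open>Here \<open>e * X e = N / e\<close>, and this \<open>e\<close> cancels
          against the one in \<open>r div e\<close>, so that only a sum of totients depends on
          \<open>e\<close>.\<close>
        also have "real e * X e * (totient (r div e) / real (r div e)) = N / real r * totient (r div e)"
          using e1 r0 unfolding dec(6)[OF e] by (simp add: X_def field_simps power2_eq_square)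
        also have "real e * sqrt (X e * B) = sqrt (N * B)"
          using e1 by (simp add: X_def real_sqrt_divide)
        also have "4 * real e + 2 ^ 99 * (N / real r * totient (r div e) + real e * 2 ^ wr + 4 ^ w * sqrt (N * B))
          \<le> 4 * real r + 2 ^ 99 * (N / real r * totient (r div e) + real r * 2 ^ wr + 4 ^ w * sqrt (N * B))"
          using dec(7)[OF e] by (intro add_mono mult_left_mono mult_right_mono order_refl) auto
        finally show "4 * real e * (1 + (\<Sum>n\<in>Z (X e) (r div e). W e (1 * n)) + (\<Sum>n\<in>Z (X e) (r div e). W e ((-1) * n)))
            \<le> 4 * real r + 2 ^ 99 * (N / real r * totient (r div e) + real r * 2 ^ wr + 4 ^ w * sqrt (N * B))" .
      qed
      also have "\<dots> = 4 * (real r * \<tau>) + 2 ^ 99 * (N / real r * (\<Sum>e\<in>D. real (totient (r div e))) + real r * \<tau> * 2 ^ wr + \<tau> * 4 ^ w * sqrt (N * B))"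
        by (simp only: sum.distrib sum_distrib_left[symmetric] sum_constant \<tau>_def) (simp add: mult_ac)
      also have "(\<Sum>e\<in>D. real (totient (r div e))) = real r"
      proof -
        have "(\<Sum>e\<in>D. totient (r div e)) = (\<Sum>d\<in>D. totient d)"
          using r0 unfolding D_def
          by (intro sum.reindex_bij_witness[of _ "\<lambda>d. r div d" "\<lambda>d. r div d"]) (auto elim!: dvdE)
        also have "\<dots> = r" unfolding D_def by (rule totient_divisor_sum)
        finally show ?thesis by (simp flip: of_nat_sum)
      qed
      also have "N / real r * real r = N" using r0 by simp
      also have "real r * \<tau> * 2 ^ wr \<le> (C1 * C2) * real r powr (1 + \<epsilon>)"
      proof -
        have r_pow2: "real r powr (2 * \<kappa>) = real r powr \<kappa> * real r powr \<kappa>"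
          by (simp flip: powr_add)
        have "2 ^ wr \<le> C2 * real r powr \<kappa>" using C2(2)[OF r0] w4[of wr] by (simp add: wr_def)
        then have "real r * \<tau> * 2 ^ wr \<le> real r * (C1 * real r powr \<kappa>) * (C2 * real r powr \<kappa>)"
          using \<tau> \<tau>0 C1 by (intro mult_mono) auto
        also have "\<dots> = (C1 * C2) * (real r * real r powr (2 * \<kappa>))"
          unfolding r_pow2 by (simp only: mult_ac)
        also have "\<dots> \<le> (C1 * C2) * real r powr (1 + \<epsilon>)"
          using r_pow[OF \<kappa>(2)] C1 C2 by (intro mult_left_mono) auto
        finally show ?thesis .
      qed
      also have "real r * \<tau> \<le> C1 * real r powr (1 + \<epsilon>)"
      proof -
        have "real r * \<tau> \<le> real r * (C1 * real r powr \<kappa>)" using \<tau> by (rule mult_left_mono) simp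
        also have "\<dots> \<le> C1 * real r powr (1 + \<epsilon>)"
          using r_pow[OF \<kappa>(3)] C1(1) by (simp add: mult.left_commute)
        finally show ?thesis .
      qed
      also have "\<tau> * 4 ^ w * sqrt (N * B) \<le> C1 * C2 * sqrt C4 * N"
      proof -
        have "(12 ^ w / real q powr (1/48)) powr (1/8) \<le> (C3 * real q powr (1/96) / real q powr (1/48)) powr (1/8)"
          using C3(2)[OF q] q by (intro powr_mono2 divide_right_mono) (auto simp: w_def)
        also have "\<dots> = (C3 * real q powr (- 1/96)) powr (1/8)"
          unfolding times_divide_eq_right[symmetric] powr_diff[symmetric] by simp
        also have "\<dots> = C3 powr (1/8) * real q powr (- 1/768)"
          using C3(1) by (simp add: powr_mult powr_powr)
        finally have b1: "N * (12 ^ w / real q powr (1/48)) powr (1/8) \<le> N * (C3 powr (1/8) * real q powr (- 1/768))"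
          using N by (intro mult_left_mono) auto
        \<comment> \<open>The cost of the translations lies below the threshold by 3/8 - 35/96 =
          1/96, and \<open>q powr (3/8) \<le> N\<close> in this range. Of the two savings, 1/96 here
          and 1/768 above, only the smaller one is kept.\<close>
        have "real q powr (35/96) = real q powr (3/8) * real q powr (- 1/96)" by (simp flip: powr_add)
        also have "\<dots> \<le> N * real q powr (- 1/768)"
          using False N q1 by (intro mult_mono powr_mono) auto
        finally have "B \<le> C4 * N * real q powr (- 1/768)"
          using b1 by (simp add: B_def C4_def algebra_simps)
        then have "N * B \<le> N * (C4 * N * real q powr (- 1/768))" using N by (intro mult_left_mono) auto
        also have "\<dots> = C4 * (N * real q powr (- 1/1536))\<^sup>2"
          by (simp add: power2_eq_square mult_ac flip: powr_add)
        finally have "sqrt (N * B) \<le> sqrt (C4 * (N * real q powr (- 1/1536))\<^sup>2)" by (rule real_sqrt_le_mono)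
        also have "\<dots> = sqrt C4 * (N * real q powr (- 1/1536))" using N by (simp add: real_sqrt_mult)
        finally have s: "sqrt (N * B) \<le> sqrt C4 * (N * real q powr (- 1/1536))" .
        have q_pow: "real q powr (2 * \<kappa> - 1/1536) = real q powr \<kappa> * (real q powr \<kappa> * real q powr (- 1/1536))"
          by (simp flip: powr_add)
        have "4 ^ w \<le> C2 * real q powr \<kappa>" using C2(2)[OF q] by (simp add: w_def)
        then have "\<tau> * 4 ^ w * sqrt (N * B) \<le> (C1 * real q powr \<kappa>) * (C2 * real q powr \<kappa>) * (sqrt C4 * (N * real q powr (- 1/1536)))"
          using \<tau>q \<tau>0 s N B0 C1 C2 by (intro mult_mono) auto
        also have "\<dots> = C1 * C2 * sqrt C4 * N * real q powr (2 * \<kappa> - 1/1536)"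
          unfolding q_pow by (simp only: mult_ac)
        also have "\<dots> \<le> C1 * C2 * sqrt C4 * N * real q powr 0"
          using \<kappa> q1 N C1 C2 C4 by (intro mult_left_mono powr_mono) auto
        finally show ?thesis using q by simp
      qed
      finally have 1: "real (A_count q \<delta>) \<le> 4 * (C1 * real r powr (1 + \<epsilon>))
          + 2 ^ 99 * (N + C1 * C2 * real r powr (1 + \<epsilon>) + C1 * C2 * sqrt C4 * N)" by simp
      have R: "N \<le> R" "real r powr (1 + \<epsilon>) \<le> R" "R \<ge> 0" using N by (auto simp: R_def)
      have "4 * (C1 * real r powr (1 + \<epsilon>)) + 2 ^ 99 * (N + C1 * C2 * real r powr (1 + \<epsilon>) + C1 * C2 * sqrt C4 * N)
        \<le> 4 * (C1 * R) + 2 ^ 99 * (R + C1 * C2 * R + C1 * C2 * sqrt C4 * R)"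
        using R C1 C2 C4 by (intro add_mono mult_left_mono) auto
      also have "\<dots> \<le> C * R"
        using R C1 C2 by (simp add: C_def algebra_simps)
      finally show ?thesis using 1 by linarith
    qed
    then show "real (A_count q \<delta>) \<le>
        C * (\<delta> * real q + real r powr (1 + \<epsilon>) + \<delta> powr (1/2) * real q powr (11/16 + \<epsilon>))"
      by (simp only: R_def N_def)
  qed
qed

end
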